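(* In the model-free setting described in the context, assume that the selection procedure $\delta$ is stable with respect to $\Theta$. Assume also that $n/p$, $\|\beta\|^2$, $\frac{\|\theta_b\|^2}{\mathrm{Var}[f(X)]}$ and $\frac{E(\|b\|^2)}{n\mathrm{Var}[f(X)]}$ are bounded, and $\frac{\|\mathbf{A}\|_F^2}{n^2}\to0$, $\frac{\|\mathbf{B}\|_F^2}{n^2\mathrm{Var}[f(X)]}\to0$, and $\frac{\|\mathbf{C}\|_F^2}{\{n\mathrm{Var}[f(X)]\}^2}\to0$. In addition, assume that the first four moments of $T_h$, $T_{\hat h}$, $T_f$ and $T_{\hat f}$ are bounded. Then $$\sqrt n\left[T_{\hat h}-T_h\right]\overset{p}{\rightarrow}0 .$$
   Context: Setting. $(X_1,Y_1),\dots,(X_n,Y_n)$ are i.i.d. copies of $(X,Y)$ with $X=(X_{\cdot1},\dots,X_{\cdot p})^T\in\mathbb{R}^p$, $Y\in\mathbb{R}$, $E(Y^2)<\infty$, $E(X)=0$, $\mathrm{Var}(X)=\mathbf{I}$; the distribution of $X$ is known. No linearity of $E(Y|X)$ is assumed. $(\alpha,\beta)=\arg\min_{a,b}E(Y-a-b^TX)^2$, so $\beta=E(XY)$; $\tau^2=\|\beta\|^2$. Limits are as $n\to\infty$ with $p=p_n$ a function of $n$. $W=XY$, $W_i=X_iY_i\in\mathbb{R}^p$, $\hat\tau^2=\binom n2^{-1}\sum_{i_1<i_2}W_{i_1}^TW_{i_2}$; $\|\cdot\|_F$ is the Frobenius norm. Selection. A covariate selection procedure $\delta$ is a rule which, for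 every dataset, chooses a subset $\mathbf{S}_\delta\subseteq\{1,\dots,p\}$. It is stable with respect to a deterministic sequence of subsets $\Theta=\Theta_n\subseteq\{1,\dots,p\}$ if $\lim_{n\to\infty}n[P(\mathbf{S}_\delta\ne\Theta)]^{1/2}=0$. Estimators. For a set $S\subseteq\{1,\dots,p\}$ and $x\in\mathbb{R}^p$ let $q_S(x)=\sum_{j<j';\,j,j'\in S}x_jx_{j'}$, $Z_S=\frac1n\sum_{i=1}^nq_S(X_i)$, $v_S=\mathrm{Var}[q_S(X)]$, $\theta_S=E[Wq_S(X)]$ (computed for the fixed set $S$), and $$c_S^*=\frac{2\beta^T\theta_S}{v_S},\qquad \hat c_S^*=\frac{\frac{2}{n(n-1)}\sum_{i_1\ne i_2}W_{i_1}^TW_{i_2}\,q_S(X_{i_2})}{v_S},$$ with the corrections $c_S^*Z_S$ and $\hat c_S^*Z_S$ read as $0$ when $v_S=0$. With $S=\mathbf{S}_\delta$ (so $h=q_{\mathbf{S}_\delta}$), put $T_h=\hat\tau^2-c^*_{\mathbf{S}_\delta}Z_{\mathbf{S}_\delta}$ (oracle) and $T_{\hat h}=\hat\tau^2-\hat c^*_{\mathbf{S}_\delta}Z_{\mathbf{S}_\delta}$. With $S=\Theta$ (so $f=q_\Theta$), put $T_f=\hat\tau^2-c^*_\Theta Z_\Theta$ and $T_{\hat f}=\hat\tau^2-\hat c^*_\Theta Z_\Theta$. Further notation: $b=Wf(X)$, $\theta_b=E(b)$, $\mathbf{A}=E(WW^T)$, $\mathbf{B}=E[WW^Tf(X)]$,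 $\mathbf{C}=E[WW^Tf^2(X)]$. *)

theory Defs
  imports "HOL-Probability.Probability"
begin

text \<open>
  An observation is a pair \<open>(x, y)\<close>; the covariate vector \<open>x \<in> \<real>\<^sup>p\<close> is a function whose relevant
  coordinates are \<open>1, \<dots>, p\<close>, because \<open>p = p\<^sub>n\<close> varies with the sample size. The population pair
  \<open>(X, Y)\<close> is given by its joint law \<open>D\<close> on \<open>data_space p\<close>: expectations of functions of \<open>(X, Y)\<close>
  are integrals with respect to \<open>D\<close>.
\<close>

type_synonym obs = "(nat \<Rightarrow> real) \<times> real"

definition data_space :: "nat \<Rightarrow> obs measure" where
  "data_space p = (\<Pi>\<^sub>M j\<in>{1..p}. borel) \<Otimes>\<^sub>M borel"

definition dot :: "nat \<Rightarrow> (nat \<Rightarrow> real) \<Rightarrow> (nat \<Rightarrow> real) \<Rightarrow> real" where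
  "dot p u v = (\<Sum>j=1..p. u j * v j)"

abbreviation vnorm :: "nat \<Rightarrow> (nat \<Rightarrow> real) \<Rightarrow> real" where
  "vnorm p v \<equiv> L2_set v {1..p}"

definition frobenius_norm :: "nat \<Rightarrow> (nat \<Rightarrow> nat \<Rightarrow> real) \<Rightarrow> real" where
  "frobenius_norm p A = L2_set (\<lambda>(j, k). A j k) ({1..p} \<times> {1..p})"

definition covariance :: "'a measure \<Rightarrow> ('a \<Rightarrow> real) \<Rightarrow> ('a \<Rightarrow> real) \<Rightarrow> real" where
  "covariance M f g = (\<integral>\<omega>. (f \<omega> - (\<integral>\<omega>. f \<omega> \<partial>M)) * (g \<omega> - (\<integral>\<omega>. g \<omega> \<partial>M)) \<partial>M)"

definition W :: "obs \<Rightarrow> nat \<Rightarrow> real" where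
  "W z j = fst z j * snd z"

definition q :: "nat set \<Rightarrow> (nat \<Rightarrow> real) \<Rightarrow> real" where
  "q S x = (\<Sum>(j, k) \<in> {(j, k). j \<in> S \<and> k \<in> S \<and> j < k}. x j * x k)"

text \<open>
  The last two conjuncts say that \<open>v\<^sub>S\<close> and \<open>\<theta>\<^sub>S\<close> (below) exist as finite numbers for every \<open>S\<close>.
\<close>

definition population :: "nat \<Rightarrow> obs measure \<Rightarrow> bool" where
  "population p D \<longleftrightarrow>
     prob_space D \<and> sets D = sets (data_space p) \<and>
     integrable D (\<lambda>z. (snd z)\<^sup>2) \<and>
     (\<forall>j\<in>{1..p}. integrable D (\<lambda>z. (fst z j)\<^sup>2)) \<and>
     (\<forall>j\<in>{1..p}. (\<integral>z. fst z j \<partial>D) = 0) \<and>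
     (\<forall>j\<in>{1..p}. \<forall>k\<in>{1..p}.
        covariance D (\<lambda>z. fst z j) (\<lambda>z. fst z k) = (if j = k then 1 else 0)) \<and>
     (\<forall>S\<subseteq>{1..p}. integrable D (\<lambda>z. (q S (fst z))\<^sup>2)) \<and>
     (\<forall>S\<subseteq>{1..p}. \<forall>j\<in>{1..p}. integrable D (\<lambda>z. W z j * q S (fst z)))"

definition best_linear_predictor ::
    "nat \<Rightarrow> obs measure \<Rightarrow> real \<Rightarrow> (nat \<Rightarrow> real) \<Rightarrow> bool" where
  "best_linear_predictor p D \<alpha> \<beta> \<longleftrightarrow>
     is_arg_min (\<lambda>(a, b). \<integral>z. (snd z - a - dot p b (fst z))\<^sup>2 \<partial>D) (\<lambda>_. True) (\<alpha>, \<beta>)"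

definition iid_copies ::
    "'a measure \<Rightarrow> 'i set \<Rightarrow> 'b measure \<Rightarrow> ('i \<Rightarrow> 'a \<Rightarrow> 'b) \<Rightarrow> bool" where
  "iid_copies M I D Z \<longleftrightarrow>
     prob_space.indep_vars M (\<lambda>_. D) Z I \<and> (\<forall>i\<in>I. distr M D (Z i) = D)"

definition dataset :: "nat \<Rightarrow> (nat \<Rightarrow> 'a \<Rightarrow> obs) \<Rightarrow> 'a \<Rightarrow> nat \<Rightarrow> obs" where
  "dataset n Z \<omega> = (\<lambda>i\<in>{1..n}. Z i \<omega>)"

definition selection_procedure :: "nat \<Rightarrow> nat \<Rightarrow> ((nat \<Rightarrow> obs) \<Rightarrow> nat set) \<Rightarrow> bool" where
  "selection_procedure n p \<delta> \<longleftrightarrow>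
     \<delta> \<in> (\<Pi>\<^sub>M i\<in>{1..n}. data_space p) \<rightarrow>\<^sub>M count_space (Pow {1..p})"

definition stable ::
    "(nat \<Rightarrow> 'a measure) \<Rightarrow> (nat \<Rightarrow> nat \<Rightarrow> 'a \<Rightarrow> obs) \<Rightarrow>
     (nat \<Rightarrow> (nat \<Rightarrow> obs) \<Rightarrow> nat set) \<Rightarrow> (nat \<Rightarrow> nat set) \<Rightarrow> bool" where
  "stable M Z \<delta> \<Theta> \<longleftrightarrow>
     (\<lambda>n. real n * sqrt (measure (M n) {\<omega> \<in> space (M n). \<delta> n (dataset n (Z n) \<omega>) \<noteq> \<Theta> n}))
       \<longlonglongrightarrow> 0"

definition v :: "obs measure \<Rightarrow> nat set \<Rightarrow> real" where
  "v D S = prob_space.variance D (\<lambda>z. q S (fst z))"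

definition theta :: "obs measure \<Rightarrow> nat set \<Rightarrow> nat \<Rightarrow> real" where
  "theta D S j = (\<integral>z. W z j * q S (fst z) \<partial>D)"

definition tau2_hat :: "nat \<Rightarrow> nat \<Rightarrow> (nat \<Rightarrow> obs) \<Rightarrow> real" where
  "tau2_hat n p d =
     (\<Sum>i2=1..n. \<Sum>i1\<in>{1..<i2}. dot p (W (d i1)) (W (d i2))) / real (n choose 2)"

definition Zbar :: "nat \<Rightarrow> nat set \<Rightarrow> (nat \<Rightarrow> obs) \<Rightarrow> real" where
  "Zbar n S d = (\<Sum>i=1..n. q S (fst (d i))) / real n"

text \<open>
  If \<open>v D S = 0\<close>, both coefficients are \<open>0\<close> (division by zero), so the corrections
  \<open>c\<^sub>S * Z\<^sub>S\<close> vanish, as they should by convention.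
\<close>

definition c_star :: "nat \<Rightarrow> obs measure \<Rightarrow> (nat \<Rightarrow> real) \<Rightarrow> nat set \<Rightarrow> real" where
  "c_star p D \<beta> S = 2 * dot p \<beta> (theta D S) / v D S"

definition c_hat :: "nat \<Rightarrow> nat \<Rightarrow> obs measure \<Rightarrow> nat set \<Rightarrow> (nat \<Rightarrow> obs) \<Rightarrow> real" where
  "c_hat n p D S d =
     (2 / (real n * (real n - 1)) *
       (\<Sum>i1\<in>{1..n}. \<Sum>i2\<in>{1..n} - {i1}. dot p (W (d i1)) (W (d i2)) * q S (fst (d i2)))) / v D S"

definition T_oracle ::
    "nat \<Rightarrow> nat \<Rightarrow> obs measure \<Rightarrow> (nat \<Rightarrow> real) \<Rightarrow> nat set \<Rightarrow> (nat \<Rightarrow> obs) \<Rightarrow> real" where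
  "T_oracle n p D \<beta> S d = tau2_hat n p d - c_star p D \<beta> S * Zbar n S d"

definition T_hat :: "nat \<Rightarrow> nat \<Rightarrow> obs measure \<Rightarrow> nat set \<Rightarrow> (nat \<Rightarrow> obs) \<Rightarrow> real" where
  "T_hat n p D S d = tau2_hat n p d - c_hat n p D S d * Zbar n S d"

text \<open>
  \<open>weighted_second_moment D S m\<close> is the matrix \<open>E[W W\<^sup>T q\<^sub>S(X)\<^sup>m]\<close>; for \<open>S = \<Theta>\<close> and
  \<open>m = 0, 1, 2\<close> these are the matrices \<open>A\<close>, \<open>B\<close> and \<open>C\<close>.
\<close>

definition weighted_second_moment :: "obs measure \<Rightarrow> nat set \<Rightarrow> nat \<Rightarrow> nat \<Rightarrow> nat \<Rightarrow> real" where
  "weighted_second_moment D S m j k = (\<integral>z. W z j * W z k * q S (fst z) ^ m \<partial>D)"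

definition weighted_second_moment_exists :: "nat \<Rightarrow> obs measure \<Rightarrow> nat set \<Rightarrow> nat \<Rightarrow> bool" where
  "weighted_second_moment_exists p D S m \<longleftrightarrow>
     (\<forall>j\<in>{1..p}. \<forall>k\<in>{1..p}. integrable D (\<lambda>z. W z j * W z k * q S (fst z) ^ m))"

text \<open>
  Sample sizes \<open>n < 2\<close> are irrelevant: the estimators involve \<open>n choose 2\<close> pairs, and boundedness of
  a real sequence does not depend on finitely many terms.
\<close>

definition first_four_moments_bounded ::
    "(nat \<Rightarrow> 'a measure) \<Rightarrow> (nat \<Rightarrow> 'a \<Rightarrow> real) \<Rightarrow> bool" where
  "first_four_moments_bounded M T \<longleftrightarrow>
     (\<forall>k\<in>{1..4::nat}. (\<forall>n\<ge>2. integrable (M n) (\<lambda>\<omega>. T n \<omega> ^ k)) \<and>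
                      Bseq (\<lambda>n. \<integral>\<omega>. T n \<omega> ^ k \<partial>M n))"

definition tends_to_zero_in_prob ::
    "(nat \<Rightarrow> 'a measure) \<Rightarrow> (nat \<Rightarrow> 'a \<Rightarrow> real) \<Rightarrow> bool" where
  "tends_to_zero_in_prob M R \<longleftrightarrow>
     (\<forall>\<epsilon>>0. (\<lambda>n. measure (M n) {\<omega> \<in> space (M n). \<bar>R n \<omega>\<bar> > \<epsilon>}) \<longlonglongrightarrow> 0)"

end

theory Submission
  imports Defs
begin

text \<open>
  On the event that the selected set is \<open>\<Theta>\<close>, the difference of the two estimators at the selected
  set is their difference at the fixed set \<open>\<Theta>\<close>, and stability makes the complementary event
  negligible. So it is enough to treat the fixed set, where
  \<open>\<surd>n (T_hat - T_oracle) = - (c_hat - c_star) \<surd>n Zbar\<close>. Because \<open>X\<close> is centred with identity covariance,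
  \<open>q\<^sub>\<Theta>(X)\<close> has mean \<open>0\<close>, hence \<open>\<surd>n Zbar\<close> has second moment \<open>v = Var f(X)\<close>. By the Cauchy--Schwarz
  and Markov inequalities, what has to vanish is \<open>v E(c_hat - c_star)\<^sup>2\<close>
  (\<open>T_hat_minus_T_oracle_tail\<close>).

  The numerator of \<open>c_hat\<close> is a U-statistic with the bilinear kernel \<open>W\<^sub>i\<^sup>T b\<^sub>k\<close>, \<open>b = W f(X)\<close>, and it is
  unbiased for \<open>2 \<beta>\<^sup>T \<theta>\<^sub>b\<close> because the least squares slope is \<open>\<beta> = E W\<close>. Its Hoeffding decomposition
  (\<open>hoeffding_decomposition\<close>) splits the error into the two linear sums of \<open>\<beta>\<^sup>T (b\<^sub>k - \<theta>\<^sub>b)\<close> and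
  \<open>\<theta>\<^sub>b\<^sup>T (W\<^sub>i - \<beta>)\<close>, and the degenerate double sum of \<open>(W\<^sub>i - \<beta>)\<^sup>T (b\<^sub>k - \<theta>\<^sub>b)\<close>. After normalisation
  their second moments are at most \<open>\<parallel>\<beta>\<parallel>\<^sup>2 \<parallel>C\<parallel> / n\<close> and \<open>\<parallel>\<theta>\<^sub>b\<parallel>\<^sup>2 \<parallel>A\<parallel> / n\<close> for the linear parts
  and, since covariances of the degenerate kernel vanish unless the index pairs agree up to order,
  \<open>4 (\<parallel>A\<parallel> + \<parallel>\<beta>\<parallel>\<^sup>2) (\<parallel>C\<parallel> + \<parallel>\<theta>\<^sub>b\<parallel>\<^sup>2) / n\<^sup>2\<close> for the degenerate part, with Frobenius norms throughout
  (\<open>second_moment_c_hat_error\<close>). Divided by \<open>v\<close>, each of these is a product of quantities that are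
  bounded and quantities that tend to \<open>0\<close>, with at least one of the latter.
\<close>

section \<open>Square-integrable functions\<close>

definition square_integrable :: "'a measure \<Rightarrow> ('a \<Rightarrow> real) \<Rightarrow> bool" where
  "square_integrable M f \<longleftrightarrow> f \<in> borel_measurable M \<and> integrable M (\<lambda>x. (f x)\<^sup>2)"

lemma square_integrableD:
  assumes "square_integrable M f"
  shows "f \<in> borel_measurable M" "integrable M (\<lambda>x. (f x)\<^sup>2)"
  using assms by (auto simp: square_integrable_def)

lemma square_integrable_mult:
  assumes f: "square_integrable M f" and g: "square_integrable M g"
  shows "integrable M (\<lambda>x. f x * g x)"
proof (rule Bochner_Integration.integrable_bound[where f = "\<lambda>x. (f x)\<^sup>2 + (g x)\<^sup>2"])
  show "AE x in M. norm (f x * g x) \<le> norm ((f x)\<^sup>2 + (g x)\<^sup>2)"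
  proof (rule AE_I2)
    fix x
    show "norm (f x * g x) \<le> norm ((f x)\<^sup>2 + (g x)\<^sup>2)"
      using sum_squares_bound[of "\<bar>f x\<bar>" "\<bar>g x\<bar>"] abs_ge_zero[of "f x * g x"]
      unfolding real_norm_def abs_mult power2_abs by linarith
  qed
qed (use square_integrableD[OF f] square_integrableD[OF g] in auto)

lemma square_integrable_add:
  assumes f: "square_integrable M f" and g: "square_integrable M g"
  shows "square_integrable M (\<lambda>x. f x + g x)"
  using square_integrableD[OF f] square_integrableD[OF g] square_integrable_mult[OF f g]
  by (auto simp: square_integrable_def power2_sum mult.assoc)

lemma square_integrable_cmult:
  "square_integrable M f \<Longrightarrow> square_integrable M (\<lambda>x. c * f x)"
  by (auto simp: square_integrable_def power_mult_distrib)

lemma square_integrable_sum: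
  assumes "\<And>i. i \<in> I \<Longrightarrow> square_integrable M (f i)"
  shows "square_integrable M (\<lambda>x. \<Sum>i\<in>I. f i x)"
  using assms
proof (induction I rule: infinite_finite_induct)
  case (insert i I)
  then show ?case by (simp add: square_integrable_add)
qed (simp_all add: square_integrable_def)

lemma (in prob_space) square_integrable_const: "square_integrable M (\<lambda>_. c)"
  by (simp add: square_integrable_def)

lemma (in prob_space) square_integrable_diff_const:
  "square_integrable M f \<Longrightarrow> square_integrable M (\<lambda>x. f x - c)"
  using square_integrable_add[OF _ square_integrable_const[of "-c"], of f] by simp

lemma (in prob_space) square_integrable_integrable:
  "square_integrable M f \<Longrightarrow> integrable M f"
  using square_integrable_mult[OF _ square_integrable_const[of 1]] by simp

lemma integral_double_sum:
  fixes f :: "'i \<Rightarrow> 'k \<Rightarrow> 'a \<Rightarrow> real"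
  assumes "\<And>i k. i \<in> I \<Longrightarrow> k \<in> K \<Longrightarrow> integrable M (f i k)"
  shows "(\<integral>x. (\<Sum>i\<in>I. \<Sum>k\<in>K. f i k x) \<partial>M) = (\<Sum>i\<in>I. \<Sum>k\<in>K. \<integral>x. f i k x \<partial>M)"
proof -
  have "(\<integral>x. (\<Sum>i\<in>I. \<Sum>k\<in>K. f i k x) \<partial>M) = (\<Sum>i\<in>I. \<integral>x. (\<Sum>k\<in>K. f i k x) \<partial>M)"
    by (intro Bochner_Integration.integral_sum Bochner_Integration.integrable_sum assms)
  also have "\<dots> = (\<Sum>i\<in>I. \<Sum>k\<in>K. \<integral>x. f i k x \<partial>M)"
    by (intro sum.cong refl Bochner_Integration.integral_sum assms)
  finally show ?thesis .
qed

lemma Cauchy_Schwarz_integral: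
  assumes f: "square_integrable M f" and g: "square_integrable M g"
  shows "(\<integral>x. \<bar>f x * g x\<bar> \<partial>M) \<le> sqrt ((\<integral>x. (f x)\<^sup>2 \<partial>M) * (\<integral>x. (g x)\<^sup>2 \<partial>M))"
proof -
  have nn: "(\<integral>\<^sup>+x. ennreal (u x) \<partial>M) = ennreal (\<integral>x. u x \<partial>M)"
    if "integrable M u" "\<And>x. 0 \<le> u x" for u :: "'a \<Rightarrow> real"
    using that by (intro nn_integral_eq_integral) auto
  have "(\<integral>\<^sup>+x. ennreal \<bar>f x\<bar> * ennreal \<bar>g x\<bar> \<partial>M)\<^sup>2
      \<le> (\<integral>\<^sup>+x. (ennreal \<bar>f x\<bar>)\<^sup>2 \<partial>M) * (\<integral>\<^sup>+x. (ennreal \<bar>g x\<bar>)\<^sup>2 \<partial>M)"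
    using square_integrableD[OF f] square_integrableD[OF g]
    by (intro Cauchy_Schwarz_nn_integral) auto
  also have "(\<integral>\<^sup>+x. ennreal \<bar>f x\<bar> * ennreal \<bar>g x\<bar> \<partial>M) = ennreal (\<integral>x. \<bar>f x * g x\<bar> \<partial>M)"
    using square_integrable_mult[OF f g]
    by (simp add: nn[symmetric] ennreal_mult[symmetric] abs_mult[symmetric])
  finally have "(\<integral>x. \<bar>f x * g x\<bar> \<partial>M)\<^sup>2 \<le> (\<integral>x. (f x)\<^sup>2 \<partial>M) * (\<integral>x. (g x)\<^sup>2 \<partial>M)"
    using square_integrableD[OF f] square_integrableD[OF g]
    by (simp add: ennreal_power nn ennreal_mult'[symmetric])
  then show ?thesis
    by (rule real_le_rsqrt)
qed

section \<open>Second moments of sums over an independent sample\<close>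

context prob_space
begin

lemma iid_copies_measurable:
  assumes "iid_copies M I D Z" "i \<in> I"
  shows "Z i \<in> M \<rightarrow>\<^sub>M D"
  using assms by (auto simp: iid_copies_def indep_vars_def)

lemma expectation_iid_copies:
  fixes g :: "'b \<Rightarrow> real"
  assumes "iid_copies M I D Z" "i \<in> I" "g \<in> borel_measurable D"
  shows "expectation (\<lambda>\<omega>. g (Z i \<omega>)) = (\<integral>z. g z \<partial>D)"
  using integral_distr[OF iid_copies_measurable[OF assms(1,2)] assms(3)] assms(1,2)
  by (simp add: iid_copies_def)

lemma square_integrable_iid_copies:
  assumes iid: "iid_copies M I D Z" and i: "i \<in> I" and g: "square_integrable D g"
  shows "square_integrable M (\<lambda>\<omega>. g (Z i \<omega>))"
proof -
  have "integrable (distr M D (Z i)) (\<lambda>z. (g z)\<^sup>2)"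
    using iid i square_integrableD[OF g] by (simp add: iid_copies_def)
  from integrable_distr[OF iid_copies_measurable[OF iid i] this]
  show ?thesis
    using iid_copies_measurable[OF iid i] square_integrableD[OF g]
    by (auto simp: square_integrable_def)
qed

lemma indep_var_one_vs_rest:
  assumes iid: "iid_copies M I D Z" and i: "i \<in> I" "J \<subseteq> I" "i \<notin> J"
    and g: "g \<in> D \<rightarrow>\<^sub>M N" and G: "G \<in> (\<Pi>\<^sub>M j\<in>J. D) \<rightarrow>\<^sub>M N'"
  shows "indep_var N (\<lambda>\<omega>. g (Z i \<omega>)) N' (\<lambda>\<omega>. G (\<lambda>j\<in>J. Z j \<omega>))"
proof -
  have "indep_var (\<Pi>\<^sub>M j\<in>{i}. D) (\<lambda>\<omega>. \<lambda>j\<in>{i}. Z j \<omega>) (\<Pi>\<^sub>M j\<in>J. D) (\<lambda>\<omega>. \<lambda>j\<in>J. Z j \<omega>)"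
    using iid i by (intro indep_var_restrict[where I = I]) (auto simp: iid_copies_def)
  moreover have "(\<lambda>x. g (x i)) \<in> (\<Pi>\<^sub>M j\<in>{i}. D) \<rightarrow>\<^sub>M N"
    using g by measurable
  ultimately show ?thesis
    using indep_var_compose[OF _ _ G, of "\<Pi>\<^sub>M j\<in>{i}. D" "\<lambda>\<omega>. \<lambda>j\<in>{i}. Z j \<omega>"
        "\<lambda>\<omega>. \<lambda>j\<in>J. Z j \<omega>" "\<lambda>x. g (x i)" N] by (simp add: comp_def)
qed

text \<open>
  The source of all vanishing covariances below: a centred factor at an index that occurs nowhere
  else in the product is independent of the remaining factors.
\<close>

lemma expectation_centred_mult_rest:
  fixes g :: "'b \<Rightarrow> real"
  assumes iid: "iid_copies M I D Z" and i: "i \<in> I" "J \<subseteq> I" "i \<notin> J"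
    and g: "square_integrable D g" "(\<integral>z. g z \<partial>D) = 0"
    and G: "G \<in> borel_measurable (\<Pi>\<^sub>M j\<in>J. D)" "integrable M (\<lambda>\<omega>. G (\<lambda>j\<in>J. Z j \<omega>))"
  shows "integrable M (\<lambda>\<omega>. g (Z i \<omega>) * G (\<lambda>j\<in>J. Z j \<omega>))"
    and "expectation (\<lambda>\<omega>. g (Z i \<omega>) * G (\<lambda>j\<in>J. Z j \<omega>)) = 0"
proof -
  note ind = indep_var_one_vs_rest[OF iid i square_integrableD(1)[OF g(1)] G(1)]
  have int: "integrable M (\<lambda>\<omega>. g (Z i \<omega>))"
    by (intro square_integrable_integrable square_integrable_iid_copies[OF iid i(1) g(1)])
  show "integrable M (\<lambda>\<omega>. g (Z i \<omega>) * G (\<lambda>j\<in>J. Z j \<omega>))"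
    by (rule indep_var_integrable[OF ind int G(2)])
  show "expectation (\<lambda>\<omega>. g (Z i \<omega>) * G (\<lambda>j\<in>J. Z j \<omega>)) = 0"
    using indep_var_lebesgue_integral[OF ind int G(2)]
      expectation_iid_copies[OF iid i(1) square_integrableD(1)[OF g(1)]] g(2)
    by simp
qed

lemma iid_copies_mult:
  fixes g h :: "'b \<Rightarrow> real"
  assumes iid: "iid_copies M I D Z" and ik: "i \<in> I" "k \<in> I" "i \<noteq> k"
    and g: "integrable D g" and h: "integrable D h"
  shows "integrable M (\<lambda>\<omega>. g (Z i \<omega>) * h (Z k \<omega>))"
    and "expectation (\<lambda>\<omega>. g (Z i \<omega>) * h (Z k \<omega>)) = (\<integral>z. g z \<partial>D) * (\<integral>z. h z \<partial>D)"
proof -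
  have meas: "g \<in> borel_measurable D" "h \<in> borel_measurable D"
    using g h by auto
  have ind: "indep_var borel (\<lambda>\<omega>. g (Z i \<omega>)) borel (\<lambda>\<omega>. h (Z k \<omega>))"
    using indep_var_one_vs_rest[OF iid ik(1), of "{k}" g borel "\<lambda>x. h (x k)"] ik meas
    by simp
  have int: "integrable M (\<lambda>\<omega>. u (Z a \<omega>))" if "integrable D u" "a \<in> I" for u :: "'b \<Rightarrow> real" and a
    using integrable_distr[OF iid_copies_measurable[OF iid that(2)], of u] iid that
    by (simp add: iid_copies_def)
  show "integrable M (\<lambda>\<omega>. g (Z i \<omega>) * h (Z k \<omega>))"
    by (rule indep_var_integrable[OF ind]) (use int g h ik in auto)
  show "expectation (\<lambda>\<omega>. g (Z i \<omega>) * h (Z k \<omega>)) = (\<integral>z. g z \<partial>D) * (\<integral>z. h z \<partial>D)"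
    using indep_var_lebesgue_integral[OF ind int[OF g ik(1)] int[OF h ik(2)]]
      expectation_iid_copies[OF iid] ik meas by simp
qed

lemma square_integrable_iid_copies_mult:
  assumes iid: "iid_copies M I D Z" and ik: "i \<in> I" "k \<in> I" "i \<noteq> k"
    and g: "square_integrable D g" and h: "square_integrable D h"
  shows "square_integrable M (\<lambda>\<omega>. g (Z i \<omega>) * h (Z k \<omega>))"
  using iid_copies_mult(1)[OF iid ik square_integrableD(2)[OF g] square_integrableD(2)[OF h]]
    square_integrableD(1)[OF square_integrable_iid_copies[OF iid ik(1) g]]
    square_integrableD(1)[OF square_integrable_iid_copies[OF iid ik(2) h]]
  by (simp add: square_integrable_def power_mult_distrib)

lemma second_moment_centred_sum:
  assumes iid: "iid_copies M I D Z" and I: "finite I" and prob: "prob_space D"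
    and g: "square_integrable D g" "(\<integral>z. g z \<partial>D) = 0"
  shows "expectation (\<lambda>\<omega>. (\<Sum>i\<in>I. g (Z i \<omega>))\<^sup>2) = card I * (\<integral>z. (g z)\<^sup>2 \<partial>D)"
proof -
  have int: "integrable D g"
    by (rule prob_space.square_integrable_integrable[OF prob g(1)])
  have si: "square_integrable M (\<lambda>\<omega>. g (Z i \<omega>))" if "i \<in> I" for i
    using square_integrable_iid_copies[OF iid that g(1)] .
  have cov: "expectation (\<lambda>\<omega>. g (Z i \<omega>) * g (Z k \<omega>)) = (if k = i then \<integral>z. (g z)\<^sup>2 \<partial>D else 0)"
    if "i \<in> I" "k \<in> I" for i k
    using iid_copies_mult(2)[OF iid that _ int int] g(2) square_integrableD[OF g(1)]
      expectation_iid_copies[OF iid that(1), of "\<lambda>z. (g z)\<^sup>2"]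
    by (auto simp: power2_eq_square)
  have "expectation (\<lambda>\<omega>. (\<Sum>i\<in>I. g (Z i \<omega>))\<^sup>2) =
      (\<Sum>i\<in>I. \<Sum>k\<in>I. expectation (\<lambda>\<omega>. g (Z i \<omega>) * g (Z k \<omega>)))"
    unfolding power2_eq_square sum_product
    by (intro integral_double_sum square_integrable_mult si)
  also have "\<dots> = (\<Sum>i\<in>I. \<Sum>k\<in>I. if k = i then \<integral>z. (g z)\<^sup>2 \<partial>D else 0)"
    by (intro sum.cong refl cov)
  also have "\<dots> = card I * (\<integral>z. (g z)\<^sup>2 \<partial>D)"
    using I by simp
  finally show ?thesis .
qed

text \<open>
  Two ordered pairs of distinct indices that differ even up to swapping contain an index that
  occurs only once. The centred factor at this index makes the covariance of the corresponding
  terms vanish. So each of the \<open>n (n - 1)\<close> terms is correlated at most with itself and with its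
  swapped companion, and every covariance is at most the common second moment \<open>T\<close> of the terms.
\<close>

lemma second_moment_degenerate_kernel_sum:
  fixes g h :: "'j \<Rightarrow> 'b \<Rightarrow> real" and I :: "'i set"
  assumes iid: "iid_copies M I D Z" and I: "finite I"
    and g: "\<And>j. j \<in> J \<Longrightarrow> square_integrable D (g j)" "\<And>j. j \<in> J \<Longrightarrow> (\<integral>z. g j z \<partial>D) = 0"
    and h: "\<And>j. j \<in> J \<Longrightarrow> square_integrable D (h j)" "\<And>j. j \<in> J \<Longrightarrow> (\<integral>z. h j z \<partial>D) = 0"
  defines "\<xi> \<equiv> \<lambda>a \<omega>. \<Sum>j\<in>J. g j (Z (fst a) \<omega>) * h j (Z (snd a) \<omega>)"
    and "P \<equiv> SIGMA i:I. I - {i}"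
    and "T \<equiv> \<Sum>j\<in>J. \<Sum>l\<in>J. (\<integral>z. g j z * g l z \<partial>D) * (\<integral>z. h j z * h l z \<partial>D)"
  shows "square_integrable M (\<lambda>\<omega>. \<Sum>a\<in>P. \<xi> a \<omega>)"
    and "expectation (\<lambda>\<omega>. (\<Sum>a\<in>P. \<xi> a \<omega>)\<^sup>2) \<le> 2 * (real (card I) * (real (card I) - 1)) * T"
proof -
  have \<xi>_eq: "\<xi> a = (\<lambda>\<omega>. \<Sum>j\<in>J. g j (Z (fst a) \<omega>) * h j (Z (snd a) \<omega>))" for a
    by (simp add: \<xi>_def)
  have P: "fst a \<in> I" "snd a \<in> I" "fst a \<noteq> snd a" if "a \<in> P" for a
    using that by (auto simp: P_def)
  have finP: "finite P"
    using I by (auto simp: P_def)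
  have si: "square_integrable M (\<xi> a)" if "a \<in> P" for a
    unfolding \<xi>_def using P[OF that]
    by (intro square_integrable_sum square_integrable_iid_copies_mult[OF iid] g h) auto
  then show "square_integrable M (\<lambda>\<omega>. \<Sum>a\<in>P. \<xi> a \<omega>)"
    by (rule square_integrable_sum)
  have diag: "expectation (\<lambda>\<omega>. (\<xi> a \<omega>)\<^sup>2) = T" if a: "a \<in> P" for a
  proof -
    have sq: "(\<xi> a \<omega>)\<^sup>2 = (\<Sum>j\<in>J. \<Sum>l\<in>J. (g j (Z (fst a) \<omega>) * g l (Z (fst a) \<omega>)) *
        (h j (Z (snd a) \<omega>) * h l (Z (snd a) \<omega>)))" for \<omega>
      by (simp add: \<xi>_def power2_eq_square sum_product ac_simps)
    note mult = iid_copies_mult[OF iid P[OF a]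
        square_integrable_mult[OF g(1) g(1)] square_integrable_mult[OF h(1) h(1)]]
    have "expectation (\<lambda>\<omega>. (\<xi> a \<omega>)\<^sup>2) = (\<Sum>j\<in>J. \<Sum>l\<in>J. expectation (\<lambda>\<omega>.
        (g j (Z (fst a) \<omega>) * g l (Z (fst a) \<omega>)) * (h j (Z (snd a) \<omega>) * h l (Z (snd a) \<omega>))))"
      unfolding sq
      by (intro integral_double_sum mult(1))
    also have "\<dots> = T"
      unfolding T_def by (intro sum.cong refl mult(2))
    finally show ?thesis .
  qed
  have off_diag: "expectation (\<lambda>\<omega>. \<xi> a \<omega> * \<xi> b \<omega>) = 0"
    if a: "a \<in> P" and b: "b \<in> P" and ne: "b \<noteq> a" "b \<noteq> (snd a, fst a)" for a b
  proof -
    let ?\<xi> = "\<lambda>x. \<Sum>l\<in>J. g l (x (fst b)) * h l (x (snd b))"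
    have gm: "g j \<in> borel_measurable D" and hm: "h j \<in> borel_measurable D" if "j \<in> J" for j
      using g(1)[OF that] h(1)[OF that] by (auto simp: square_integrable_def)
    have coord: "(\<lambda>x. u (x i)) \<in> borel_measurable (\<Pi>\<^sub>M j\<in>K. D)"
      if "i \<in> K" "u \<in> borel_measurable D" for u :: "'b \<Rightarrow> real" and i and K :: "'i set"
      using that by measurable
    \<comment> \<open>Equal entries within a pair are excluded, so if both entries of \<open>a\<close> occurred in \<open>b\<close>, then
      \<open>a\<close> would be \<open>b\<close> or its swap.\<close>
    consider "fst a \<notin> {fst b, snd b}" | "snd a \<notin> {fst b, snd b}"
      using ne P[OF a] P[OF b] by (metis insert_iff prod.collapse singletonD)
    then show ?thesis
    proof cases
      case 1
      let ?J = "{snd a, fst b, snd b}"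
      have J: "?J \<subseteq> I" "fst a \<notin> ?J"
        using 1 P[OF a] P[OF b] by auto
      have m: "(\<lambda>x. h j (x (snd a)) * ?\<xi> x) \<in> borel_measurable (\<Pi>\<^sub>M j\<in>?J. D)" if "j \<in> J" for j
        by (intro borel_measurable_times borel_measurable_sum coord gm hm that) auto
      have i: "integrable M (\<lambda>\<omega>. h j (Z (snd a) \<omega>) * \<xi> b \<omega>)" if "j \<in> J" for j
        by (intro square_integrable_mult si b square_integrable_iid_copies[OF iid] h(1) that P a)
      have *: "integrable M (\<lambda>\<omega>. g j (Z (fst a) \<omega>) * (h j (Z (snd a) \<omega>) * \<xi> b \<omega>)) \<and>
          expectation (\<lambda>\<omega>. g j (Z (fst a) \<omega>) * (h j (Z (snd a) \<omega>) * \<xi> b \<omega>)) = 0" if "j \<in> J" for j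
        using expectation_centred_mult_rest[OF iid P(1)[OF a] J g[OF that] m[OF that]] i[OF that]
        by (simp add: \<xi>_def)
      have "expectation (\<lambda>\<omega>. \<xi> a \<omega> * \<xi> b \<omega>) =
          (\<Sum>j\<in>J. expectation (\<lambda>\<omega>. g j (Z (fst a) \<omega>) * (h j (Z (snd a) \<omega>) * \<xi> b \<omega>)))"
        unfolding \<xi>_eq[of a] sum_distrib_right mult.assoc
        by (rule Bochner_Integration.integral_sum) (use * in auto)
      then show ?thesis using * by simp
    next
      case 2
      let ?J = "{fst a, fst b, snd b}"
      have J: "?J \<subseteq> I" "snd a \<notin> ?J"
        using 2 P[OF a] P[OF b] by auto
      have m: "(\<lambda>x. g j (x (fst a)) * ?\<xi> x) \<in> borel_measurable (\<Pi>\<^sub>M j\<in>?J. D)" if "j \<in> J" for j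
        by (intro borel_measurable_times borel_measurable_sum coord gm hm that) auto
      have i: "integrable M (\<lambda>\<omega>. g j (Z (fst a) \<omega>) * \<xi> b \<omega>)" if "j \<in> J" for j
        by (intro square_integrable_mult si b square_integrable_iid_copies[OF iid] g(1) that P a)
      have *: "integrable M (\<lambda>\<omega>. h j (Z (snd a) \<omega>) * (g j (Z (fst a) \<omega>) * \<xi> b \<omega>)) \<and>
          expectation (\<lambda>\<omega>. h j (Z (snd a) \<omega>) * (g j (Z (fst a) \<omega>) * \<xi> b \<omega>)) = 0" if "j \<in> J" for j
        using expectation_centred_mult_rest[OF iid P(2)[OF a] J h[OF that] m[OF that]] i[OF that]
        by (simp add: \<xi>_def)
      have "expectation (\<lambda>\<omega>. \<xi> a \<omega> * \<xi> b \<omega>) =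
          (\<Sum>j\<in>J. expectation (\<lambda>\<omega>. h j (Z (snd a) \<omega>) * (g j (Z (fst a) \<omega>) * \<xi> b \<omega>)))"
        unfolding \<xi>_eq[of a] sum_distrib_right mult.assoc mult.left_commute[of "g _ _" "h _ _"]
        by (rule Bochner_Integration.integral_sum) (use * in auto)
      then show ?thesis using * by simp
    qed
  qed
  have le: "expectation (\<lambda>\<omega>. \<xi> a \<omega> * \<xi> b \<omega>) \<le> T" if "a \<in> P" "b \<in> P" for a b
  proof -
    have "expectation (\<lambda>\<omega>. \<xi> a \<omega> * \<xi> b \<omega>) \<le> expectation (\<lambda>\<omega>. ((\<xi> a \<omega>)\<^sup>2 + (\<xi> b \<omega>)\<^sup>2) / 2)"
    proof (rule integral_mono)
      show "\<xi> a \<omega> * \<xi> b \<omega> \<le> ((\<xi> a \<omega>)\<^sup>2 + (\<xi> b \<omega>)\<^sup>2) / 2" for \<omega>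
        using sum_squares_bound[of "\<xi> a \<omega>" "\<xi> b \<omega>"] by simp
      show "integrable M (\<lambda>\<omega>. \<xi> a \<omega> * \<xi> b \<omega>)"
        by (intro square_integrable_mult si that)
    qed (use square_integrableD(2)[OF si] that in auto)
    also have "\<dots> = T"
      using diag that square_integrableD(2)[OF si] by simp
    finally show ?thesis .
  qed
  have row: "(\<Sum>b\<in>P. expectation (\<lambda>\<omega>. \<xi> a \<omega> * \<xi> b \<omega>)) \<le> 2 * T" if a: "a \<in> P" for a
  proof -
    have swap: "(snd a, fst a) \<in> P" "(snd a, fst a) \<noteq> a"
      using P[OF a] by (auto simp: P_def prod_eq_iff)
    have "(\<Sum>b\<in>P. expectation (\<lambda>\<omega>. \<xi> a \<omega> * \<xi> b \<omega>)) =
        (\<Sum>b\<in>{a, (snd a, fst a)}. expectation (\<lambda>\<omega>. \<xi> a \<omega> * \<xi> b \<omega>))"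
      using a swap finP off_diag[OF a] by (intro sum.mono_neutral_right) auto
    also have "\<dots> \<le> 2 * T"
      using swap(2) le[OF a a] le[OF a swap(1)] by simp
    finally show ?thesis .
  qed
  have card: "real (card P) = real (card I) * (real (card I) - 1)"
  proof -
    have "card P = (\<Sum>i\<in>I. card I - 1)"
      using I by (simp add: P_def card_SigmaI)
    then show ?thesis
      using I by (cases "card I = 0") (auto simp: of_nat_diff algebra_simps)
  qed
  have "expectation (\<lambda>\<omega>. (\<Sum>a\<in>P. \<xi> a \<omega>)\<^sup>2) =
      (\<Sum>a\<in>P. \<Sum>b\<in>P. expectation (\<lambda>\<omega>. \<xi> a \<omega> * \<xi> b \<omega>))"
    unfolding power2_eq_square sum_product
    by (intro integral_double_sum square_integrable_mult si)
  also have "\<dots> \<le> (\<Sum>a\<in>P. 2 * T)"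
    by (intro sum_mono row)
  also have "\<dots> = 2 * (real (card I) * (real (card I) - 1)) * T"
    using card by simp
  finally show "expectation (\<lambda>\<omega>. (\<Sum>a\<in>P. \<xi> a \<omega>)\<^sup>2) \<le> 2 * (real (card I) * (real (card I) - 1)) * T" .
qed

end


section \<open>Frobenius norm bounds\<close>

lemma frobenius_norm_nonneg: "0 \<le> frobenius_norm p A"
  by (simp add: frobenius_norm_def)

lemma sum_mult_le_frobenius_norm:
  "(\<Sum>j=1..p. \<Sum>l=1..p. A j l * C j l) \<le> frobenius_norm p A * frobenius_norm p C"
proof -
  have "(\<Sum>j=1..p. \<Sum>l=1..p. A j l * C j l) = (\<Sum>(j, l)\<in>{1..p} \<times> {1..p}. A j l * C j l)"
    by (simp add: sum.cartesian_product)
  also have "\<dots> \<le> (\<Sum>x\<in>{1..p} \<times> {1..p}. \<bar>case x of (j, l) \<Rightarrow> A j l\<bar> * \<bar>case x of (j, l) \<Rightarrow> C j l\<bar>)"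
    by (intro sum_mono) (auto simp: abs_mult[symmetric])
  also have "\<dots> \<le> frobenius_norm p A * frobenius_norm p C"
    unfolding frobenius_norm_def by (rule L2_set_mult_ineq)
  finally show ?thesis .
qed

lemma frobenius_norm_rank_one:
  "frobenius_norm p (\<lambda>j l. u j * u l) = (vnorm p u)\<^sup>2"
proof -
  have "(\<Sum>x\<in>{1..p} \<times> {1..p}. (case x of (j, l) \<Rightarrow> u j * u l)\<^sup>2) = (\<Sum>j=1..p. (u j)\<^sup>2)\<^sup>2"
    by (subst power2_eq_square[of "sum _ _"])
       (simp add: sum_product sum.cartesian_product power_mult_distrib case_prod_unfold)
  then show ?thesis
    by (simp add: frobenius_norm_def L2_set_def sum_nonneg)
qed

text \<open>
  Covariance matrices arise as \<open>A - u u\<^sup>T\<close> from the matrix \<open>A\<close> of raw second moments and the mean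
  vector \<open>u\<close>.
\<close>

lemma frobenius_norm_minus_rank_one:
  "frobenius_norm p (\<lambda>j l. A j l - u j * u l) \<le> frobenius_norm p A + (vnorm p u)\<^sup>2"
proof -
  have "frobenius_norm p (\<lambda>j l. A j l - u j * u l) =
      L2_set (\<lambda>x. (case x of (j, l) \<Rightarrow> A j l) + - (case x of (j, l) \<Rightarrow> u j * u l)) ({1..p} \<times> {1..p})"
    by (simp add: frobenius_norm_def case_prod_unfold)
  also have "\<dots> \<le> frobenius_norm p A +
      L2_set (\<lambda>x. - (case x of (j, l) \<Rightarrow> u j * u l)) ({1..p} \<times> {1..p})"
    unfolding frobenius_norm_def by (rule L2_set_triangle_ineq)
  also have "L2_set (\<lambda>x. - (case x of (j, l) \<Rightarrow> u j * u l)) ({1..p} \<times> {1..p}) = (vnorm p u)\<^sup>2"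
    unfolding frobenius_norm_rank_one[symmetric] by (simp add: frobenius_norm_def L2_set_def)
  finally show ?thesis .
qed

text \<open>
  Subtracting \<open>m m\<^sup>T\<close> lowers the quadratic form by \<open>(u\<^sup>T m)\<^sup>2\<close>, so centring costs nothing here.
\<close>

lemma quadratic_form_minus_rank_one_le:
  "(\<Sum>j=1..p. \<Sum>l=1..p. (u j * u l) * (A j l - m j * m l)) \<le> (vnorm p u)\<^sup>2 * frobenius_norm p A"
proof -
  have "(\<Sum>j=1..p. \<Sum>l=1..p. (u j * u l) * (A j l - m j * m l)) =
      (\<Sum>j=1..p. \<Sum>l=1..p. (u j * u l) * A j l) - (\<Sum>j=1..p. u j * m j)\<^sup>2"
    by (simp add: power2_eq_square sum_product sum_subtractf[symmetric] algebra_simps)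
  also have "\<dots> \<le> (\<Sum>j=1..p. \<Sum>l=1..p. (u j * u l) * A j l)"
    by simp
  also have "\<dots> \<le> (vnorm p u)\<^sup>2 * frobenius_norm p A"
    using sum_mult_le_frobenius_norm[of "\<lambda>j l. u j * u l"] by (simp add: frobenius_norm_rank_one)
  finally show ?thesis .
qed

section \<open>The population and its least squares slope\<close>

lemma observation_measurable:
  assumes "sets D = sets (data_space p)"
  shows "snd \<in> borel_measurable D"
    and "j \<in> {1..p} \<Longrightarrow> (\<lambda>z. fst z j) \<in> borel_measurable D"
    and "j \<in> {1..p} \<Longrightarrow> (\<lambda>z. W z j) \<in> borel_measurable D"
    and "S \<subseteq> {1..p} \<Longrightarrow> (\<lambda>z. q S (fst z)) \<in> borel_measurable D"
proof -
  note cong = measurable_cong_sets[OF assms refl]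
  show y: "snd \<in> borel_measurable D"
    unfolding cong data_space_def by measurable
  show x: "(\<lambda>z. fst z j) \<in> borel_measurable D" if "j \<in> {1..p}" for j
    unfolding cong data_space_def
    by (intro measurable_compose[OF measurable_fst measurable_component_singleton] that)
  show "(\<lambda>z. W z j) \<in> borel_measurable D" if "j \<in> {1..p}"
    unfolding W_def by (intro borel_measurable_times x y that)
  show "(\<lambda>z. q S (fst z)) \<in> borel_measurable D" if "S \<subseteq> {1..p}"
    unfolding q_def case_prod_unfold
    by (intro borel_measurable_sum borel_measurable_times x) (use that in auto)
qed

lemma population_square_integrable:
  assumes "population p D"
  shows "square_integrable D snd"
    and "j \<in> {1..p} \<Longrightarrow> square_integrable D (\<lambda>z. fst z j)"
    and "S \<subseteq> {1..p} \<Longrightarrow> square_integrable D (\<lambda>z. q S (fst z))"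
  using assms observation_measurable[of D p] by (auto simp: population_def square_integrable_def)

lemma population_cross_moment:
  assumes "population p D" "j \<in> {1..p}" "k \<in> {1..p}"
  shows "(\<integral>z. fst z j * fst z k \<partial>D) = (if j = k then 1 else 0)"
  using assms by (auto simp: population_def covariance_def)

lemma population_mean_q:
  assumes pop: "population p D" and S: "S \<subseteq> {1..p}"
  shows "(\<integral>z. q S (fst z) \<partial>D) = 0"
proof -
  have "(\<integral>z. q S (fst z) \<partial>D) =
      (\<Sum>x\<in>{(j, k). j \<in> S \<and> k \<in> S \<and> j < k}. \<integral>z. fst z (fst x) * fst z (snd x) \<partial>D)"
    unfolding q_def case_prod_unfold
    by (intro Bochner_Integration.integral_sum square_integrable_mult
        population_square_integrable[OF pop]) (use S in auto)
  also have "\<dots> = 0"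
    using S by (intro sum.neutral) (auto simp: population_cross_moment[OF pop] subset_eq)
  finally show ?thesis .
qed

lemma v_eq_second_moment:
  assumes "population p D" "S \<subseteq> {1..p}"
  shows "v D S = (\<integral>z. (q S (fst z))\<^sup>2 \<partial>D)"
  by (simp add: v_def population_mean_q[OF assms])

text \<open>
  The residual \<open>R\<close> of the minimiser is orthogonal to \<open>X\<^sub>j\<close>: as \<open>E X\<^sub>j\<^sup>2 = 1\<close>, changing the \<open>j\<close>-th slope by
  \<open>t = E(R X\<^sub>j)\<close> changes the loss by \<open>t\<^sup>2 - 2 t\<^sup>2 = - t\<^sup>2\<close>, which minimality forces to be \<open>0\<close>. Since
  \<open>X\<close> is centred with identity covariance, \<open>E(R X\<^sub>j) = 0\<close> reads \<open>\<beta>\<^sub>j = E(Y X\<^sub>j)\<close>.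
\<close>

lemma best_linear_predictor_slope:
  assumes pop: "population p D" and blp: "best_linear_predictor p D \<alpha> \<beta>" and j: "j \<in> {1..p}"
  shows "\<beta> j = (\<integral>z. W z j \<partial>D)"
proof -
  interpret D: prob_space D
    using pop by (simp add: population_def)
  note si = population_square_integrable[OF pop]
  define R where "R = (\<lambda>z :: obs. snd z - \<alpha> - dot p \<beta> (fst z))"
  have siR: "square_integrable D R"
  proof -
    have "square_integrable D (\<lambda>z. (snd z + (- \<alpha>)) + (\<Sum>k=1..p. - \<beta> k * fst z k))"
      by (intro square_integrable_add square_integrable_sum square_integrable_cmult si
          D.square_integrable_const) auto
    then show ?thesis by (simp add: R_def dot_def sum_negf)
  qed
  define t where "t = (\<integral>z. R z * fst z j \<partial>D)"
  have int: "integrable D (\<lambda>z. R z * fst z j)"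
    by (intro square_integrable_mult siR si j)
  have "(\<integral>z. (R z)\<^sup>2 \<partial>D) \<le> (\<integral>z. (snd z - \<alpha> - dot p (\<beta>(j := \<beta> j + t)) (fst z))\<^sup>2 \<partial>D)"
    using blp unfolding best_linear_predictor_def is_arg_min_def R_def
    by (auto simp: not_less)
  also have "\<dots> = (\<integral>z. (R z)\<^sup>2 + (t\<^sup>2 * (fst z j * fst z j) - 2 * t * (R z * fst z j)) \<partial>D)"
  proof (rule Bochner_Integration.integral_cong[OF refl])
    fix z :: obs
    have "dot p (\<beta>(j := \<beta> j + t)) (fst z) = dot p \<beta> (fst z) + t * fst z j"
    proof -
      have "dot p (\<beta>(j := \<beta> j + t)) (fst z) =
          (\<Sum>k=1..p. \<beta> k * fst z k + (if k = j then t * fst z j else 0))"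
        unfolding dot_def by (intro sum.cong) (auto simp: algebra_simps)
      also have "\<dots> = dot p \<beta> (fst z) + t * fst z j"
        using j by (simp add: sum.distrib dot_def)
      finally show ?thesis .
    qed
    then have eq: "snd z - \<alpha> - dot p (\<beta>(j := \<beta> j + t)) (fst z) = R z - t * fst z j"
      by (simp add: R_def)
    show "(snd z - \<alpha> - dot p (\<beta>(j := \<beta> j + t)) (fst z))\<^sup>2 =
        (R z)\<^sup>2 + (t\<^sup>2 * (fst z j * fst z j) - 2 * t * (R z * fst z j))"
      unfolding eq by (simp add: power2_eq_square algebra_simps)
  qed
  also have "\<dots> = (\<integral>z. (R z)\<^sup>2 \<partial>D) + (t\<^sup>2 * (\<integral>z. fst z j * fst z j \<partial>D) - 2 * t * t)"
    using square_integrableD[OF siR] int square_integrable_mult[OF si(2)[OF j] si(2)[OF j]]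
    by (simp add: t_def)
  also have "\<dots> = (\<integral>z. (R z)\<^sup>2 \<partial>D) - t\<^sup>2"
    using population_cross_moment[OF pop j j] by (simp add: power2_eq_square)
  finally have "t = 0"
    by simp
  have "t = (\<integral>z. W z j - \<alpha> * fst z j - (\<Sum>k=1..p. \<beta> k * (fst z k * fst z j)) \<partial>D)"
    unfolding t_def R_def W_def dot_def by (simp add: algebra_simps sum_distrib_left)
  also have "\<dots> = (\<integral>z. W z j \<partial>D) - \<alpha> * (\<integral>z. fst z j \<partial>D) -
      (\<Sum>k=1..p. \<beta> k * (\<integral>z. fst z k * fst z j \<partial>D))"
  proof -
    have "integrable D (\<lambda>z. W z j)"
      unfolding W_def by (intro square_integrable_mult si j)
    moreover have "integrable D (\<lambda>z. \<alpha> * fst z j)"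
      by (intro integrable_mult_right D.square_integrable_integrable si j)
    moreover have k: "integrable D (\<lambda>z. \<beta> k * (fst z k * fst z j))" if "k \<in> {1..p}" for k
      by (intro integrable_mult_right square_integrable_mult si j that)
    then have "integrable D (\<lambda>z. \<Sum>k=1..p. \<beta> k * (fst z k * fst z j))"
      by (rule Bochner_Integration.integrable_sum)
    moreover have "(\<integral>z. (\<Sum>k=1..p. \<beta> k * (fst z k * fst z j)) \<partial>D) =
        (\<Sum>k=1..p. \<beta> k * (\<integral>z. fst z k * fst z j \<partial>D))"
      by (subst Bochner_Integration.integral_sum) (use k in \<open>simp_all only: integral_mult_right_zero\<close>)
    ultimately show ?thesis
      by (simp only: Bochner_Integration.integral_diff Bochner_Integration.integrable_diff
          integral_mult_right_zero)
  qed
  also have "(\<Sum>k=1..p. \<beta> k * (\<integral>z. fst z k * fst z j \<partial>D)) = (\<Sum>k=1..p. if k = j then \<beta> j else 0)"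
    by (intro sum.cong) (auto simp: population_cross_moment[OF pop _ j] simp del: atLeastAtMost_iff)
  also have "(\<integral>z. fst z j \<partial>D) = 0"
    using pop j by (simp add: population_def)
  finally show ?thesis
    using \<open>t = 0\<close> j by simp
qed


section \<open>The mean squared error of the estimated coefficient\<close>

lemma second_moment_sum3_le:
  assumes "square_integrable M F" "square_integrable M G" "square_integrable M H"
  shows "(\<integral>x. (F x + G x + H x)\<^sup>2 \<partial>M) \<le>
      3 * ((\<integral>x. (F x)\<^sup>2 \<partial>M) + (\<integral>x. (G x)\<^sup>2 \<partial>M) + (\<integral>x. (H x)\<^sup>2 \<partial>M))"
proof -
  note int = assms[THEN square_integrableD(2)]
  have "(\<integral>x. (F x + G x + H x)\<^sup>2 \<partial>M) \<le> (\<integral>x. 3 * ((F x)\<^sup>2 + (G x)\<^sup>2 + (H x)\<^sup>2) \<partial>M)"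
  proof (rule integral_mono)
    show "(F x + G x + H x)\<^sup>2 \<le> 3 * ((F x)\<^sup>2 + (G x)\<^sup>2 + (H x)\<^sup>2)" for x
      using sum_squares_bound[of "F x" "G x"] sum_squares_bound[of "F x" "H x"]
        sum_squares_bound[of "G x" "H x"]
      by (simp add: power2_eq_square algebra_simps)
    show "integrable M (\<lambda>x. (F x + G x + H x)\<^sup>2)"
      by (intro square_integrableD(2) square_integrable_add assms)
  qed (use int in auto)
  also have "\<dots> = 3 * ((\<integral>x. (F x)\<^sup>2 \<partial>M) + (\<integral>x. (G x)\<^sup>2 \<partial>M) + (\<integral>x. (H x)\<^sup>2 \<partial>M))"
    using int by simp
  finally show ?thesis .
qed

lemma (in prob_space) integral_centred_mult:
  assumes f: "square_integrable M f" and g: "square_integrable M g"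
  shows "expectation (\<lambda>x. (f x - expectation f) * (g x - expectation g)) =
      expectation (\<lambda>x. f x * g x) - expectation f * expectation g"
proof -
  have "expectation (\<lambda>x. (f x - expectation f) * (g x - expectation g)) =
      expectation (\<lambda>x. f x * g x - expectation g * f x - expectation f * g x + expectation f * expectation g)"
    by (simp add: algebra_simps)
  also have "\<dots> = expectation (\<lambda>x. f x * g x) - expectation f * expectation g"
    using square_integrable_mult[OF f g] square_integrable_integrable[OF f]
      square_integrable_integrable[OF g]
    by (simp add: prob_space)
  finally show ?thesis .
qed

lemma (in prob_space) integral_centred:
  assumes f: "square_integrable M f"
  shows "expectation (\<lambda>x. f x - expectation f) = 0"
  using square_integrable_integrable[OF f] by (simp add: prob_space)

lemma weighted_second_moment_square_integrable:
  assumes pop: "population p D" and S: "S \<subseteq> {1..p}" and j: "j \<in> {1..p}"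
    and ex: "weighted_second_moment_exists p D S (2 * m)"
  shows "square_integrable D (\<lambda>z. W z j * q S (fst z) ^ m)"
proof -
  have "integrable D (\<lambda>z. (W z j * q S (fst z) ^ m)\<^sup>2)"
    using ex j unfolding weighted_second_moment_exists_def
    by (auto simp: power_mult_distrib power_mult[symmetric] power2_eq_square[of "W _ _"] mult.commute)
  moreover have "(\<lambda>z. W z j * q S (fst z) ^ m) \<in> borel_measurable D"
    using observation_measurable(3,4)[of D p] pop S j
    by (intro borel_measurable_times borel_measurable_power) (auto simp: population_def)
  ultimately show ?thesis
    by (simp add: square_integrable_def)
qed

text \<open>
  Used for the two linear parts of the Hoeffding decomposition; the second moment is the quadratic
  form at \<open>u\<close> of the covariance matrix \<open>K - m m\<^sup>T\<close>.
\<close>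

lemma second_moment_centred_dot:
  assumes D: "prob_space D"
    and g: "\<And>j. j \<in> {1..p} \<Longrightarrow> square_integrable D (\<lambda>z. g z j)"
    and mean: "\<And>j. j \<in> {1..p} \<Longrightarrow> m j = (\<integral>z. g z j \<partial>D)"
    and K: "\<And>j l. j \<in> {1..p} \<Longrightarrow> l \<in> {1..p} \<Longrightarrow> K j l = (\<integral>z. g z j * g z l \<partial>D)"
  shows "square_integrable D (\<lambda>z. dot p u (\<lambda>j. g z j - m j))"
    and "(\<integral>z. dot p u (\<lambda>j. g z j - m j) \<partial>D) = 0"
    and "(\<integral>z. (dot p u (\<lambda>j. g z j - m j))\<^sup>2 \<partial>D) \<le> (vnorm p u)\<^sup>2 * frobenius_norm p K"
proof -
  interpret D: prob_space D by (rule D)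
  have si: "square_integrable D (\<lambda>z. g z j - m j)" if "j \<in> {1..p}" for j
    by (rule D.square_integrable_diff_const[OF g[OF that]])
  show "square_integrable D (\<lambda>z. dot p u (\<lambda>j. g z j - m j))"
    unfolding dot_def by (intro square_integrable_sum square_integrable_cmult si)
  have zero: "(\<integral>z. g z j - m j \<partial>D) = 0" if "j \<in> {1..p}" for j
    using D.integral_centred[OF g[OF that]] mean[OF that] by simp
  have "(\<integral>z. dot p u (\<lambda>j. g z j - m j) \<partial>D) = (\<Sum>j=1..p. \<integral>z. u j * (g z j - m j) \<partial>D)"
    unfolding dot_def
    by (intro Bochner_Integration.integral_sum integrable_mult_right
        D.square_integrable_integrable si)
  also have "\<dots> = 0"
    by (intro sum.neutral ballI) (simp only: integral_mult_right_zero zero)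
  finally show "(\<integral>z. dot p u (\<lambda>j. g z j - m j) \<partial>D) = 0" .
  have "(\<integral>z. (dot p u (\<lambda>j. g z j - m j))\<^sup>2 \<partial>D) =
      (\<integral>z. (\<Sum>j=1..p. \<Sum>l=1..p. (u j * u l) * ((g z j - m j) * (g z l - m l))) \<partial>D)"
    by (simp add: dot_def power2_eq_square sum_product ac_simps)
  also have "\<dots> = (\<Sum>j=1..p. \<Sum>l=1..p. \<integral>z. (u j * u l) * ((g z j - m j) * (g z l - m l)) \<partial>D)"
    by (intro integral_double_sum integrable_mult_right square_integrable_mult si)
  also have "\<dots> = (\<Sum>j=1..p. \<Sum>l=1..p. (u j * u l) * (K j l - m j * m l))"
    using D.integral_centred_mult[OF g g]
    by (intro sum.cong refl) (simp only: integral_mult_right_zero mean K)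
  also have "\<dots> \<le> (vnorm p u)\<^sup>2 * frobenius_norm p K"
    by (rule quadratic_form_minus_rank_one_le)
  finally show "(\<integral>z. (dot p u (\<lambda>j. g z j - m j))\<^sup>2 \<partial>D) \<le> (vnorm p u)\<^sup>2 * frobenius_norm p K" .
qed

text \<open>
  Insert \<open>w\<^sub>i = m + (w\<^sub>i - m)\<close> and \<open>\<eta>\<^sub>k = t + (\<eta>\<^sub>k - t)\<close> into the bilinear kernel; each index has
  \<open>n - 1\<close> partners, which produces the weight of the linear parts. When \<open>m\<close> and \<open>t\<close> are the
  means in an independent sample, every part but the constant is centred.
\<close>

lemma hoeffding_decomposition:
  fixes w \<eta> :: "'i \<Rightarrow> nat \<Rightarrow> real"
  assumes I: "finite I"
  shows "(\<Sum>i\<in>I. \<Sum>k\<in>I - {i}. dot p (w i) (\<eta> k)) =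
    real (card I) * (real (card I) - 1) * dot p m t
    + (real (card I) - 1) * (\<Sum>i\<in>I. dot p m (\<lambda>j. \<eta> i j - t j))
    + (real (card I) - 1) * (\<Sum>i\<in>I. dot p t (\<lambda>j. w i j - m j))
    + (\<Sum>a\<in>(SIGMA i:I. I - {i}). \<Sum>j=1..p. (w (fst a) j - m j) * (\<eta> (snd a) j - t j))"
proof -
  have dot: "dot p (w i) (\<eta> k) = dot p m t + dot p m (\<lambda>j. \<eta> k j - t j) + dot p t (\<lambda>j. w i j - m j)
      + (\<Sum>j=1..p. (w i j - m j) * (\<eta> k j - t j))" for i k
    unfolding dot_def sum.distrib[symmetric] by (intro sum.cong) (auto simp: algebra_simps)
  have const: "(\<Sum>k\<in>I - {i}. c) = (real (card I) - 1) * c" if "i \<in> I" for i and c :: real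
  proof -
    have "card I \<ge> 1"
      using that I card_gt_0_iff[of I] by (auto simp: Suc_le_eq)
    then show ?thesis
      using that I by (simp add: of_nat_diff)
  qed
  have swap: "(\<Sum>i\<in>I. \<Sum>k\<in>I - {i}. c k) = (real (card I) - 1) * (\<Sum>k\<in>I. c k)" for c :: "'i \<Rightarrow> real"
    using I by (simp add: sum_diff1 sum_subtractf left_diff_distrib)
  have "(\<Sum>i\<in>I. \<Sum>k\<in>I - {i}. dot p (w i) (\<eta> k)) =
      (\<Sum>i\<in>I. \<Sum>k\<in>I - {i}. dot p m t) + (\<Sum>i\<in>I. \<Sum>k\<in>I - {i}. dot p m (\<lambda>j. \<eta> k j - t j))
      + (\<Sum>i\<in>I. \<Sum>k\<in>I - {i}. dot p t (\<lambda>j. w i j - m j))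
      + (\<Sum>i\<in>I. \<Sum>k\<in>I - {i}. \<Sum>j=1..p. (w i j - m j) * (\<eta> k j - t j))"
    by (simp add: dot sum.distrib)
  also have "(\<Sum>i\<in>I. \<Sum>k\<in>I - {i}. \<Sum>j=1..p. (w i j - m j) * (\<eta> k j - t j)) =
      (\<Sum>a\<in>(SIGMA i:I. I - {i}). \<Sum>j=1..p. (w (fst a) j - m j) * (\<eta> (snd a) j - t j))"
    using I by (subst sum.Sigma) (auto simp: case_prod_unfold)
  finally show ?thesis
    by (simp only: swap, simp add: const sum_distrib_left del: sum_constant cong: sum.cong, simp)
qed


text \<open>
  The three terms on the right are the contributions of the two linear parts and of the degenerate
  part of the Hoeffding decomposition. The factor \<open>12\<close> is \<open>2\<^sup>2\<close> from the numerator \<open>2 \<beta>\<^sup>T \<theta>\<close> times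
  \<open>3\<close> from squaring a sum of three parts. The degenerate part contributes at most
  \<open>2 / (n (n - 1))\<close>, hence at most \<open>4 / n\<^sup>2\<close>, times the trace of \<open>Cov(W) Cov(b)\<close>.
\<close>

lemma (in prob_space) second_moment_c_hat_error:
  assumes pop: "population p D" and S: "S \<subseteq> {1..p}" and v0: "v D S \<noteq> 0"
    and ex0: "weighted_second_moment_exists p D S 0" and ex2: "weighted_second_moment_exists p D S 2"
    and \<beta>: "\<And>j. j \<in> {1..p} \<Longrightarrow> \<beta> j = (\<integral>z. W z j \<partial>D)"
    and iid: "iid_copies M {1..n} D Z" and n: "n \<ge> 2"
  defines "e \<equiv> \<lambda>\<omega>. c_hat n p D S (dataset n Z \<omega>) - c_star p D \<beta> S"
    and "A \<equiv> frobenius_norm p (weighted_second_moment D S 0)"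
    and "C \<equiv> frobenius_norm p (weighted_second_moment D S 2)"
    and "s \<equiv> (vnorm p \<beta>)\<^sup>2" and "t \<equiv> (vnorm p (theta D S))\<^sup>2"
  shows "square_integrable M e"
    and "(v D S)\<^sup>2 * expectation (\<lambda>\<omega>. (e \<omega>)\<^sup>2) \<le>
      12 * (s * C / real n + t * A / real n + 4 * ((A + s) * (C + t)) / (real n)\<^sup>2)"
proof -
  have D: "prob_space D"
    using pop by (simp add: population_def)
  interpret D: prob_space D by (rule D)
  let ?b = "\<lambda>z j. W z j * q S (fst z)" and ?\<theta> = "theta D S" and ?I = "{1..n}"
  have siW: "square_integrable D (\<lambda>z. W z j)" and sib: "square_integrable D (\<lambda>z. ?b z j)"
    if "j \<in> {1..p}" for j
    using weighted_second_moment_square_integrable[OF pop S that, of 0] ex0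
      weighted_second_moment_square_integrable[OF pop S that, of 1] ex2 by auto
  have \<theta>: "?\<theta> j = (\<integral>z. ?b z j \<partial>D)" for j
    by (simp add: theta_def)
  have KA: "weighted_second_moment D S 0 j l = (\<integral>z. W z j * W z l \<partial>D)" for j l
    by (simp add: weighted_second_moment_def)
  have KC: "weighted_second_moment D S 2 j l = (\<integral>z. ?b z j * ?b z l \<partial>D)" for j l
    by (simp add: weighted_second_moment_def power2_eq_square ac_simps)
  note \<phi> = second_moment_centred_dot[where p = p and u = \<beta>, OF D sib \<theta> KC]
  note \<psi> = second_moment_centred_dot[where p = p and u = ?\<theta>, OF D siW \<beta> KA]
  let ?\<phi> = "\<lambda>z. dot p \<beta> (\<lambda>j. ?b z j - ?\<theta> j)" and ?\<psi> = "\<lambda>z. dot p ?\<theta> (\<lambda>j. W z j - \<beta> j)"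
  define F where "F = (\<lambda>\<omega>. (1 / real n) * (\<Sum>i\<in>?I. ?\<phi> (Z i \<omega>)))"
  define G where "G = (\<lambda>\<omega>. (1 / real n) * (\<Sum>i\<in>?I. ?\<psi> (Z i \<omega>)))"
  define X where "X = (\<lambda>\<omega>. \<Sum>a\<in>(SIGMA i:?I. ?I - {i}). \<Sum>j=1..p.
      (W (Z (fst a) \<omega>) j - \<beta> j) * (?b (Z (snd a) \<omega>) j - ?\<theta> j))"
  define H where "H = (\<lambda>\<omega>. (1 / (real n * (real n - 1))) * X \<omega>)"
  have ve: "v D S * e \<omega> = 2 * (F \<omega> + G \<omega> + H \<omega>)" for \<omega>
  proof -
    have "(\<Sum>i1\<in>?I. \<Sum>i2\<in>?I - {i1}. dot p (W (dataset n Z \<omega> i1)) (W (dataset n Z \<omega> i2)) *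
          q S (fst (dataset n Z \<omega> i2))) =
        (\<Sum>i1\<in>?I. \<Sum>i2\<in>?I - {i1}. dot p (W (Z i1 \<omega>)) (?b (Z i2 \<omega>)))"
      by (intro sum.cong refl) (auto simp: dataset_def dot_def sum_distrib_right mult.assoc)
    also have "\<dots> = real n * (real n - 1) * dot p \<beta> ?\<theta>
        + (real n - 1) * (\<Sum>i\<in>?I. ?\<phi> (Z i \<omega>)) + (real n - 1) * (\<Sum>i\<in>?I. ?\<psi> (Z i \<omega>)) + X \<omega>"
      unfolding X_def by (subst hoeffding_decomposition[where m = \<beta> and t = ?\<theta>]) simp_all
    finally have U: "v D S * e \<omega> = 2 / (real n * (real n - 1)) * (real n * (real n - 1) * dot p \<beta> ?\<theta>
        + (real n - 1) * (\<Sum>i\<in>?I. ?\<phi> (Z i \<omega>)) + (real n - 1) * (\<Sum>i\<in>?I. ?\<psi> (Z i \<omega>)) + X \<omega>)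
        - 2 * dot p \<beta> ?\<theta>"
      using v0 by (simp add: e_def c_hat_def c_star_def right_diff_distrib)
    have "real n \<noteq> 0" "real n - 1 \<noteq> 0"
      using n by auto
    then show ?thesis
      unfolding U F_def G_def H_def by (simp add: field_simps)
  qed
  have siF: "square_integrable M F" and siG: "square_integrable M G"
    unfolding F_def G_def
    by (intro square_integrable_cmult square_integrable_sum square_integrable_iid_copies[OF iid] \<phi>(1) \<psi>(1);
        assumption)+
  have zero: "(\<integral>z. W z j - \<beta> j \<partial>D) = 0" "(\<integral>z. ?b z j - ?\<theta> j \<partial>D) = 0" if "j \<in> {1..p}" for j
    using D.integral_centred[OF siW[OF that]] D.integral_centred[OF sib[OF that]] \<beta>[OF that] \<theta>[of j]
    by simp_all
  note kernel = second_moment_degenerate_kernel_sum[OF iid finite_atLeastAtMost, of "{1..p}"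
      "\<lambda>j z. W z j - \<beta> j" "\<lambda>j z. ?b z j - ?\<theta> j",
      OF D.square_integrable_diff_const[OF siW] zero(1) D.square_integrable_diff_const[OF sib] zero(2)]
  have siH: "square_integrable M H"
    unfolding H_def X_def by (intro square_integrable_cmult kernel(1)) auto
  have "square_integrable M (\<lambda>\<omega>. (1 / v D S) * (2 * (F \<omega> + G \<omega> + H \<omega>)))"
    by (intro square_integrable_cmult square_integrable_add siF siG siH)
  then show "square_integrable M e"
    unfolding ve[symmetric] using v0 by simp
  have F2: "expectation (\<lambda>\<omega>. (F \<omega>)\<^sup>2) \<le> s * C / real n"
  proof -
    have "expectation (\<lambda>\<omega>. (F \<omega>)\<^sup>2) = (\<integral>z. (?\<phi> z)\<^sup>2 \<partial>D) / real n"
      using second_moment_centred_sum[OF iid finite_atLeastAtMost D \<phi>(1,2)] n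
      by (simp add: F_def power_divide power2_eq_square[of "real n"])
    then show ?thesis
      using \<phi>(3) by (simp add: s_def C_def divide_right_mono)
  qed
  have G2: "expectation (\<lambda>\<omega>. (G \<omega>)\<^sup>2) \<le> t * A / real n"
  proof -
    have "expectation (\<lambda>\<omega>. (G \<omega>)\<^sup>2) = (\<integral>z. (?\<psi> z)\<^sup>2 \<partial>D) / real n"
      using second_moment_centred_sum[OF iid finite_atLeastAtMost D \<psi>(1,2)] n
      by (simp add: G_def power_divide power2_eq_square[of "real n"])
    then show ?thesis
      using \<psi>(3) by (simp add: t_def A_def divide_right_mono)
  qed
  have H2: "expectation (\<lambda>\<omega>. (H \<omega>)\<^sup>2) \<le> 4 * ((A + s) * (C + t)) / (real n)\<^sup>2"
  proof -
    let ?T = "\<Sum>j=1..p. \<Sum>l=1..p. (\<integral>z. (W z j - \<beta> j) * (W z l - \<beta> l) \<partial>D) *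
        (\<integral>z. (?b z j - ?\<theta> j) * (?b z l - ?\<theta> l) \<partial>D)"
    have "?T = (\<Sum>j=1..p. \<Sum>l=1..p. (weighted_second_moment D S 0 j l - \<beta> j * \<beta> l) *
        (weighted_second_moment D S 2 j l - ?\<theta> j * ?\<theta> l))"
      using D.integral_centred_mult[OF siW siW] D.integral_centred_mult[OF sib sib]
      by (intro sum.cong refl) (simp only: \<beta> \<theta> KA KC)
    also have "\<dots> \<le> frobenius_norm p (\<lambda>j l. weighted_second_moment D S 0 j l - \<beta> j * \<beta> l) *
        frobenius_norm p (\<lambda>j l. weighted_second_moment D S 2 j l - ?\<theta> j * ?\<theta> l)"
      by (rule sum_mult_le_frobenius_norm)
    also have "\<dots> \<le> (A + s) * (C + t)"
      unfolding A_def C_def s_def t_def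
      by (intro mult_mono frobenius_norm_minus_rank_one frobenius_norm_nonneg add_nonneg_nonneg) simp
    finally have T: "?T \<le> (A + s) * (C + t)" .
    have nonneg: "0 \<le> (A + s) * (C + t)"
      by (simp add: A_def C_def s_def t_def frobenius_norm_nonneg)
    have n': "real n > 0" "real n - 1 > 0" "real n / 2 \<le> real n - 1"
      using n by auto
    have "expectation (\<lambda>\<omega>. (H \<omega>)\<^sup>2) = expectation (\<lambda>\<omega>. (X \<omega>)\<^sup>2) / (real n * (real n - 1))\<^sup>2"
      by (simp add: H_def power_divide)
    also have "\<dots> \<le> 2 * (real n * (real n - 1)) * ?T / (real n * (real n - 1))\<^sup>2"
      using kernel(2) by (intro divide_right_mono) (simp_all add: X_def)
    also have "\<dots> = 2 / (real n * (real n - 1)) * ?T"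
      using n' by (simp add: power2_eq_square)
    also have "\<dots> \<le> 2 / (real n * (real n - 1)) * ((A + s) * (C + t))"
      using n' by (intro mult_left_mono T) simp
    also have "\<dots> \<le> 2 / (real n * (real n / 2)) * ((A + s) * (C + t))"
      using n' by (intro mult_right_mono nonneg divide_left_mono mult_left_mono) auto
    finally show ?thesis
      by (simp add: power2_eq_square)
  qed
  have "(v D S)\<^sup>2 * expectation (\<lambda>\<omega>. (e \<omega>)\<^sup>2) = expectation (\<lambda>\<omega>. (v D S * e \<omega>)\<^sup>2)"
    by (simp add: power_mult_distrib)
  also have "\<dots> = 4 * expectation (\<lambda>\<omega>. (F \<omega> + G \<omega> + H \<omega>)\<^sup>2)"
    by (simp only: ve power_mult_distrib integral_mult_right_zero) simp
  also have "\<dots> \<le> 4 * (3 * (expectation (\<lambda>\<omega>. (F \<omega>)\<^sup>2) + expectation (\<lambda>\<omega>. (G \<omega>)\<^sup>2) + expectation (\<lambda>\<omega>. (H \<omega>)\<^sup>2)))"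
    by (intro mult_left_mono second_moment_sum3_le siF siG siH) simp
  also have "\<dots> \<le> 12 * (s * C / real n + t * A / real n + 4 * ((A + s) * (C + t)) / (real n)\<^sup>2)"
    using F2 G2 H2 by simp
  finally show "(v D S)\<^sup>2 * expectation (\<lambda>\<omega>. (e \<omega>)\<^sup>2) \<le>
      12 * (s * C / real n + t * A / real n + 4 * ((A + s) * (C + t)) / (real n)\<^sup>2)" .
qed

text \<open>
  Up to sign, the difference is the product of \<open>c_hat - c_star\<close> and the centred average \<open>Zbar\<close>, whose
  dependence on each other is absorbed by the Cauchy--Schwarz inequality. The quantities \<open>a\<close>, \<open>c\<close>,
  \<open>s\<close> and \<open>t\<close> carry exactly the normalisations under which the first two tend to \<open>0\<close> and the
  last two stay bounded.
\<close>

lemma (in prob_space) T_hat_minus_T_oracle_tail: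
  assumes pop: "population p D" and S: "S \<subseteq> {1..p}"
    and ex0: "weighted_second_moment_exists p D S 0" and ex2: "weighted_second_moment_exists p D S 2"
    and \<beta>: "\<And>j. j \<in> {1..p} \<Longrightarrow> \<beta> j = (\<integral>z. W z j \<partial>D)"
    and iid: "iid_copies M {1..n} D Z" and n: "n \<ge> 2" and \<epsilon>: "\<epsilon> > 0"
  defines "R \<equiv> \<lambda>\<omega>. sqrt (real n) *
      (T_hat n p D S (dataset n Z \<omega>) - T_oracle n p D \<beta> S (dataset n Z \<omega>))"
    and "a \<equiv> frobenius_norm p (weighted_second_moment D S 0) / real n"
    and "c \<equiv> frobenius_norm p (weighted_second_moment D S 2) / (real n * v D S)"
    and "s \<equiv> (vnorm p \<beta>)\<^sup>2" and "t \<equiv> (vnorm p (theta D S))\<^sup>2 / v D S"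
  shows "R \<in> borel_measurable M"
    and "prob {\<omega> \<in> space M. \<bar>R \<omega>\<bar> > \<epsilon>} \<le> sqrt (12 * (s * c + t * a + 4 * ((a + s / real n) * (c + t / real n)))) / \<epsilon>"
proof -
  have D: "prob_space D"
    using pop by (simp add: population_def)
  have v_nonneg: "v D S \<ge> 0"
    by (simp add: v_eq_second_moment[OF pop S])
  define K where "K = 12 * (s * c + t * a + 4 * ((a + s / real n) * (c + t / real n)))"
  have K: "K \<ge> 0"
    unfolding K_def s_def c_def t_def a_def using v_nonneg
    by (intro mult_nonneg_nonneg add_nonneg_nonneg divide_nonneg_nonneg frobenius_norm_nonneg) auto
  have "R \<in> borel_measurable M \<and> prob {\<omega> \<in> space M. \<bar>R \<omega>\<bar> > \<epsilon>} \<le> sqrt K / \<epsilon>"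
  proof (cases "v D S = 0")
    case True
    \<comment> \<open>Both coefficients are \<open>0\<close>, so the two estimators coincide.\<close>
    then have "R = (\<lambda>_. 0)"
      by (simp add: R_def T_hat_def T_oracle_def c_hat_def c_star_def)
    then show ?thesis
      using \<epsilon> K by simp
  next
    case False
    then have v: "v D S > 0"
      using v_nonneg by simp
    define e where "e = (\<lambda>\<omega>. c_hat n p D S (dataset n Z \<omega>) - c_star p D \<beta> S)"
    define Q where "Q = (\<lambda>\<omega>. \<Sum>i=1..n. q S (fst (Z i \<omega>)))"
    note err = second_moment_c_hat_error[OF pop S False ex0 ex2 \<beta> iid n]
    have sie: "square_integrable M e"
      using err(1) unfolding e_def .
    have siQ: "square_integrable M Q"
      unfolding Q_def
      by (intro square_integrable_sum square_integrable_iid_copies[OF iid]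
          population_square_integrable[OF pop] S)
    have Q2: "expectation (\<lambda>\<omega>. (Q \<omega>)\<^sup>2) = real n * v D S"
      using second_moment_centred_sum[OF iid finite_atLeastAtMost D
          population_square_integrable(3)[OF pop S] population_mean_q[OF pop S]]
      by (simp add: Q_def v_eq_second_moment[OF pop S])
    have R: "R \<omega> = (- 1 / sqrt (real n)) * (e \<omega> * Q \<omega>)" for \<omega>
    proof -
      have "Zbar n S (dataset n Z \<omega>) = Q \<omega> / real n"
        using n by (auto simp: Zbar_def Q_def dataset_def intro!: sum.cong arg_cong2[of _ _ _ _ "(/)"])
      then have "sqrt (real n) * Zbar n S (dataset n Z \<omega>) = Q \<omega> / sqrt (real n)"
        using sqrt_divide_self_eq[of "real n"] by (simp add: divide_inverse ac_simps)
      moreover have "R \<omega> = - e \<omega> * (sqrt (real n) * Zbar n S (dataset n Z \<omega>))"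
        by (simp add: R_def T_hat_def T_oracle_def e_def algebra_simps)
      ultimately show ?thesis
        by simp
    qed
    have int: "integrable M R"
      unfolding R[abs_def] by (intro integrable_mult_right square_integrable_mult sie siQ)
    have "v D S * expectation (\<lambda>\<omega>. (e \<omega>)\<^sup>2) \<le> K"
    proof -
      have K_eq: "12 * ((vnorm p \<beta>)\<^sup>2 * frobenius_norm p (weighted_second_moment D S 2) / real n
          + (vnorm p (theta D S))\<^sup>2 * frobenius_norm p (weighted_second_moment D S 0) / real n
          + 4 * ((frobenius_norm p (weighted_second_moment D S 0) + (vnorm p \<beta>)\<^sup>2) *
            (frobenius_norm p (weighted_second_moment D S 2) + (vnorm p (theta D S))\<^sup>2)) / (real n)\<^sup>2)
          = v D S * K"
        using v n unfolding K_def s_def a_def c_def t_def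
        by (simp add: power2_eq_square[of "real n"] field_simps)
      have "(v D S)\<^sup>2 * expectation (\<lambda>\<omega>. (e \<omega>)\<^sup>2) \<le> v D S * K"
        using err(2) unfolding K_eq e_def .
      then show ?thesis
        using v by (simp add: power2_eq_square)
    qed
    then have CS: "expectation (\<lambda>\<omega>. \<bar>e \<omega> * Q \<omega>\<bar>) \<le> sqrt (real n) * sqrt K"
    proof -
      assume le: "v D S * expectation (\<lambda>\<omega>. (e \<omega>)\<^sup>2) \<le> K"
      have "expectation (\<lambda>\<omega>. \<bar>e \<omega> * Q \<omega>\<bar>) \<le> sqrt (expectation (\<lambda>\<omega>. (e \<omega>)\<^sup>2) * (real n * v D S))"
        using Cauchy_Schwarz_integral[OF sie siQ] by (simp add: Q2)
      also have "\<dots> \<le> sqrt (real n * K)"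
        using mult_left_mono[OF le, of "real n"] by (simp add: ac_simps)
      finally show ?thesis
        by (simp add: real_sqrt_mult)
    qed
    have "expectation (\<lambda>\<omega>. \<bar>R \<omega>\<bar>) = expectation (\<lambda>\<omega>. \<bar>e \<omega> * Q \<omega>\<bar>) / sqrt (real n)"
      by (simp add: R abs_mult)
    also have "\<dots> \<le> sqrt K"
      using CS n by (simp add: field_simps)
    finally have ER: "expectation (\<lambda>\<omega>. \<bar>R \<omega>\<bar>) \<le> sqrt K" .
    have "prob {\<omega> \<in> space M. \<bar>R \<omega>\<bar> > \<epsilon>} \<le> prob {\<omega> \<in> space M. \<bar>R \<omega>\<bar> \<ge> \<epsilon>}"
      using int by (intro finite_measure_mono) auto
    also have "\<dots> \<le> expectation (\<lambda>\<omega>. \<bar>R \<omega>\<bar>) / \<epsilon>"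
      using int \<epsilon> by (intro integral_Markov_inequality_measure[where A = "{}"]) auto
    also have "\<dots> \<le> sqrt K / \<epsilon>"
      using ER \<epsilon> by (simp add: divide_right_mono)
    finally show ?thesis
      using int by auto
  qed
  then show "R \<in> borel_measurable M" "prob {\<omega> \<in> space M. \<bar>R \<omega>\<bar> > \<epsilon>} \<le>
      sqrt (12 * (s * c + t * a + 4 * ((a + s / real n) * (c + t / real n)))) / \<epsilon>"
    by (simp_all add: K_def)
qed


section \<open>From the fixed set to the selected set\<close>

lemma dataset_measurable:
  assumes iid: "iid_copies M {1..n} D Z" and D: "sets D = sets (data_space p)" and M: "prob_space M"
  shows "dataset n Z \<in> M \<rightarrow>\<^sub>M (\<Pi>\<^sub>M i\<in>{1..n}. data_space p)"
proof -
  interpret prob_space M by (rule M)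
  have "Z i \<in> M \<rightarrow>\<^sub>M data_space p" if "i \<in> {1..n}" for i
    using iid_copies_measurable[OF iid that] by (simp cong: measurable_cong_sets add: D)
  then have "(\<lambda>\<omega>. \<lambda>i\<in>{1..n}. Z i \<omega>) \<in> M \<rightarrow>\<^sub>M (\<Pi>\<^sub>M i\<in>{1..n}. data_space p)"
    by (rule measurable_restrict)
  then show ?thesis
    by (simp add: dataset_def[abs_def])
qed

lemma Bseq_mult_tendsto_zero:
  fixes X Y :: "nat \<Rightarrow> real"
  assumes "Bseq X" "Y \<longlonglongrightarrow> 0"
  shows "(\<lambda>n. X n * Y n) \<longlonglongrightarrow> 0"
  using bounded_bilinear.Bfun_prod_Zfun[OF bounded_bilinear_mult assms(1), of Y] assms(2)
  by (simp add: tendsto_Zfun_iff)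

lemma stable_imp_prob_tendsto_zero:
  assumes "stable M Z \<delta> \<Theta>"
  shows "(\<lambda>n. measure (M n) {\<omega> \<in> space (M n). \<delta> n (dataset n (Z n) \<omega>) \<noteq> \<Theta> n}) \<longlonglongrightarrow> 0"
    (is "?P \<longlonglongrightarrow> 0")
proof -
  have "(\<lambda>n. sqrt (?P n)) \<longlonglongrightarrow> 0"
  proof (rule Lim_null_comparison)
    show "\<forall>\<^sub>F n in sequentially. norm (sqrt (?P n)) \<le> real n * sqrt (?P n)"
      by (intro eventually_sequentiallyI[of 1]) (simp add: mult_le_cancel_right1)
  qed (use assms in \<open>simp add: stable_def\<close>)
  then have "(\<lambda>n. (sqrt (?P n))\<^sup>2) \<longlonglongrightarrow> 0\<^sup>2"
    by (rule tendsto_power)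
  then show ?thesis
    by simp
qed

theorem proposition3p4:
  fixes p :: "nat \<Rightarrow> nat"
    and D :: "nat \<Rightarrow> obs measure"
    and \<alpha> :: "nat \<Rightarrow> real"
    and \<beta> :: "nat \<Rightarrow> nat \<Rightarrow> real"
    and M :: "nat \<Rightarrow> 'a measure"
    and Z :: "nat \<Rightarrow> nat \<Rightarrow> 'a \<Rightarrow> obs"
    and \<delta> :: "nat \<Rightarrow> (nat \<Rightarrow> obs) \<Rightarrow> nat set"
    and \<Theta> :: "nat \<Rightarrow> nat set"
  defines "data \<equiv> \<lambda>n. dataset n (Z n)"
    and "f \<equiv> \<lambda>n x. q (\<Theta> n) x"
    and "b \<equiv> \<lambda>n z j. W z j * q (\<Theta> n) (fst z)"
  defines "Varf \<equiv> \<lambda>n. prob_space.variance (D n) (\<lambda>z. f n (fst z))"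
    and "\<theta>b \<equiv> \<lambda>n j. \<integral>z. b n z j \<partial>D n"
    and "A \<equiv> \<lambda>n. weighted_second_moment (D n) (\<Theta> n) 0"
    and "B \<equiv> \<lambda>n. weighted_second_moment (D n) (\<Theta> n) 1"
    and "C \<equiv> \<lambda>n. weighted_second_moment (D n) (\<Theta> n) 2"
    and "T_h \<equiv> \<lambda>n \<omega>. T_oracle n (p n) (D n) (\<beta> n) (\<delta> n (data n \<omega>)) (data n \<omega>)"
    and "T_h_hat \<equiv> \<lambda>n \<omega>. T_hat n (p n) (D n) (\<delta> n (data n \<omega>)) (data n \<omega>)"
    and "T_f \<equiv> \<lambda>n \<omega>. T_oracle n (p n) (D n) (\<beta> n) (\<Theta> n) (data n \<omega>)"
    and "T_f_hat \<equiv> \<lambda>n \<omega>. T_hat n (p n) (D n) (\<Theta> n) (data n \<omega>)"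
  assumes p_pos: "\<And>n. n \<ge> 2 \<Longrightarrow> p n \<ge> 1"
    and population: "\<And>n. n \<ge> 2 \<Longrightarrow> population (p n) (D n)"
    and predictor: "\<And>n. n \<ge> 2 \<Longrightarrow> best_linear_predictor (p n) (D n) (\<alpha> n) (\<beta> n)"
    and prob: "\<And>n. n \<ge> 2 \<Longrightarrow> prob_space (M n)"
    and sample: "\<And>n. n \<ge> 2 \<Longrightarrow> iid_copies (M n) {1..n} (D n) (Z n)"
    and selection: "\<And>n. n \<ge> 2 \<Longrightarrow> selection_procedure n (p n) (\<delta> n)"
    and Theta: "\<And>n. n \<ge> 2 \<Longrightarrow> \<Theta> n \<subseteq> {1..p n}"
    and stable: "stable M Z \<delta> \<Theta>"
    and exist_ABC: "\<And>n m. n \<ge> 2 \<Longrightarrow> m \<le> 2 \<Longrightarrow>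
          weighted_second_moment_exists (p n) (D n) (\<Theta> n) m"
    and bounded_n_p: "Bseq (\<lambda>n. real n / real (p n))"
    and bounded_beta: "Bseq (\<lambda>n. (vnorm (p n) (\<beta> n))\<^sup>2)"
    and bounded_theta: "Bseq (\<lambda>n. (vnorm (p n) (\<theta>b n))\<^sup>2 / Varf n)"
    and bounded_b: "Bseq (\<lambda>n. (\<integral>z. (vnorm (p n) (b n z))\<^sup>2 \<partial>D n) / (real n * Varf n))"
    and A_small: "(\<lambda>n. (frobenius_norm (p n) (A n))\<^sup>2 / (real n)\<^sup>2) \<longlonglongrightarrow> 0"
    and B_small: "(\<lambda>n. (frobenius_norm (p n) (B n))\<^sup>2 / ((real n)\<^sup>2 * Varf n)) \<longlonglongrightarrow> 0"
    and C_small: "(\<lambda>n. (frobenius_norm (p n) (C n))\<^sup>2 / (real n * Varf n)\<^sup>2) \<longlonglongrightarrow> 0"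
    and moments: "first_four_moments_bounded M T_h" "first_four_moments_bounded M T_h_hat"
          "first_four_moments_bounded M T_f" "first_four_moments_bounded M T_f_hat"
  shows "tends_to_zero_in_prob M (\<lambda>n \<omega>. sqrt (real n) * (T_h_hat n \<omega> - T_h n \<omega>))"
proof -
  let ?v = "\<lambda>n. v (D n) (\<Theta> n)"
  define P where "P n = measure (M n) {\<omega> \<in> space (M n). \<delta> n (data n \<omega>) \<noteq> \<Theta> n}" for n
  define a where "a n = frobenius_norm (p n) (A n) / real n" for n
  define c where "c n = frobenius_norm (p n) (C n) / (real n * ?v n)" for n
  define s where "s n = (vnorm (p n) (\<beta> n))\<^sup>2" for n
  define t where "t n = (vnorm (p n) (theta (D n) (\<Theta> n)))\<^sup>2 / ?v n" for n
  define K where "K n = 12 * (s n * c n + t n * a n + 4 * ((a n + s n / real n) * (c n + t n / real n)))" for n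
  have Varf: "Varf n = ?v n" for n
    by (simp add: Varf_def v_def f_def)
  have P0: "P \<longlonglongrightarrow> 0"
    using stable_imp_prob_tendsto_zero[OF stable] by (simp add: P_def[abs_def] data_def)
  have s: "Bseq s" and t: "Bseq t"
    using bounded_beta bounded_theta
    by (simp_all add: s_def[abs_def] t_def[abs_def] Varf theta_def[abs_def] \<theta>b_def b_def)
  have "(\<lambda>n. (a n)\<^sup>2) \<longlonglongrightarrow> 0" "(\<lambda>n. (c n)\<^sup>2) \<longlonglongrightarrow> 0"
    using A_small C_small by (simp_all add: a_def c_def Varf power_divide)
  then have a0: "a \<longlonglongrightarrow> 0" and c0: "c \<longlonglongrightarrow> 0"
    using tendsto_real_sqrt[of "\<lambda>n. (a n)\<^sup>2" 0 sequentially]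
      tendsto_real_sqrt[of "\<lambda>n. (c n)\<^sup>2" 0 sequentially]
    by (simp_all add: tendsto_rabs_zero_iff)
  have inv: "(\<lambda>n. X n / real n) \<longlonglongrightarrow> 0" if "Bseq X" for X
    using Bseq_mult_tendsto_zero[OF that lim_1_over_n] by simp
  have "(\<lambda>n. 12 * (s n * c n + t n * a n + 4 * ((a n + s n / real n) * (c n + t n / real n)))) \<longlonglongrightarrow>
      12 * (0 + 0 + 4 * ((0 + 0) * (0 + 0)))"
    by (intro tendsto_intros Bseq_mult_tendsto_zero inv s t a0 c0)
  then have K0: "(\<lambda>n. sqrt (K n)) \<longlonglongrightarrow> 0"
    using tendsto_real_sqrt[of K 0 sequentially] by (simp add: K_def[abs_def])
  have bound: "measure (M n) {\<omega> \<in> space (M n). \<bar>sqrt (real n) * (T_h_hat n \<omega> - T_h n \<omega>)\<bar> > \<epsilon>}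
      \<le> P n + sqrt (K n) / \<epsilon>" if n: "n \<ge> 2" and \<epsilon>: "\<epsilon> > 0" for n \<epsilon>
  proof -
    interpret prob_space "M n"
      by (rule prob[OF n])
    let ?R = "\<lambda>\<omega>. sqrt (real n) * (T_h_hat n \<omega> - T_h n \<omega>)"
    let ?R' = "\<lambda>\<omega>. sqrt (real n) * (T_f_hat n \<omega> - T_f n \<omega>)"
    let ?E = "{\<omega> \<in> space (M n). \<delta> n (data n \<omega>) \<noteq> \<Theta> n}"
    note tail = T_hat_minus_T_oracle_tail[OF population[OF n] Theta[OF n] exist_ABC[OF n, of 0]
        exist_ABC[OF n, of 2] best_linear_predictor_slope[OF population[OF n] predictor[OF n]]
        sample[OF n] n \<epsilon>]
    have meas: "?R' \<in> borel_measurable (M n)"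
      using tail(1) by (simp add: T_f_hat_def T_f_def data_def)
    have "(\<lambda>\<omega>. \<delta> n (data n \<omega>)) \<in> M n \<rightarrow>\<^sub>M count_space (Pow {1..p n})"
      using measurable_compose[OF dataset_measurable[OF sample[OF n] _ prob[OF n], of "p n"]
          selection[OF n, unfolded selection_procedure_def]] population[OF n]
      by (simp add: data_def population_def)
    then have E: "?E \<in> sets (M n)"
      by measurable
    \<comment> \<open>Off \<open>?E\<close> the selected set is \<open>\<Theta> n\<close>, and \<open>?R\<close> agrees with \<open>?R'\<close>.\<close>
    have "measure (M n) {\<omega> \<in> space (M n). \<bar>?R \<omega>\<bar> > \<epsilon>} \<le>
        measure (M n) (?E \<union> {\<omega> \<in> space (M n). \<bar>?R' \<omega>\<bar> > \<epsilon>})"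
      using E meas
      by (intro finite_measure_mono) (auto simp: T_h_hat_def T_h_def T_f_hat_def T_f_def)
    also have "\<dots> \<le> P n + measure (M n) {\<omega> \<in> space (M n). \<bar>?R' \<omega>\<bar> > \<epsilon>}"
      unfolding P_def using E meas by (intro measure_Un_le) auto
    also have "measure (M n) {\<omega> \<in> space (M n). \<bar>?R' \<omega>\<bar> > \<epsilon>} \<le> sqrt (K n) / \<epsilon>"
      using tail(2)
      by (simp add: T_f_hat_def T_f_def data_def K_def a_def c_def s_def t_def A_def C_def)
    finally show ?thesis
      by simp
  qed
  show ?thesis
    unfolding tends_to_zero_in_prob_def
  proof (intro allI impI)
    fix \<epsilon> :: real assume \<epsilon>: "\<epsilon> > 0"
    have lim: "(\<lambda>n. P n + sqrt (K n) / \<epsilon>) \<longlonglongrightarrow> 0"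
      using tendsto_add[OF P0 tendsto_divide[OF K0 tendsto_const[of \<epsilon>]]] \<epsilon> by simp
    show "(\<lambda>n. measure (M n) {\<omega> \<in> space (M n). \<bar>sqrt (real n) * (T_h_hat n \<omega> - T_h n \<omega>)\<bar> > \<epsilon>})
        \<longlonglongrightarrow> 0"
      by (rule Lim_null_comparison[OF _ lim])
         (use bound \<epsilon> in \<open>auto intro!: eventually_sequentiallyI[of 2]\<close>)
  qed
qed

end
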